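(* Let $A<\mathbb{R}$ be a subring with $A\neq\mathbb{Z}$. Then the group $H(A)$ is non-amenable.
   Context: Let $\mathbb{P}^1=\mathbb{P}^1(\mathbb{R})$ be the real projective line with its usual (real) topology, a topological circle, on which $\mathrm{PSL}_2(\mathbb{R})$ acts naturally by projective (Möbius) transformations. Let $G$ be the group of all homeomorphisms of $\mathbb{P}^1$ which are piecewise in $\mathrm{PSL}_2(\mathbb{R})$, i.e. there are finitely many intervals of $\mathbb{P}^1$ covering it such that on each interval the homeomorphism agrees with an element of $\mathrm{PSL}_2(\mathbb{R})$. Let $\infty\in\mathbb{P}^1$ be the point corresponding to the first basis vector of $\mathbb{R}^2$, and let $H<G$ be the stabilizer of $\infty$. For a subring $A<\mathbb{R}$, let $P_A\subseteq\mathbb{P}^1$ be the set of all fixed points of all hyperbolic elements (those with $|\mathrm{trace}|>2$) of $\mathrm{PSL}_2(A)$. Let $G(A)<G$ be the subgroup of elements that are piecewise in $\mathrm{PSL}_2(A)$ with all interval endpoints (breakpoints) in $P_A$, and $H(A)=G(A)\cap H$. *)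

theory Defs
  imports "HOL-Analysis.Analysis" "HOL-Algebra.Group"
begin

text \<open>The real projective line: a point is either Some t (the line through (t,1))
  or None, the point infinity corresponding to the first basis vector (1,0).
  Its topology is pulled back along the Cayley transform, a bijection onto the
  unit circle of the complex plane.\<close>

type_synonym P1 = "real option"

definition cayley :: "P1 \<Rightarrow> complex" where
  "cayley p = (case p of None \<Rightarrow> 1
      | Some t \<Rightarrow> (complex_of_real t - \<i>) / (complex_of_real t + \<i>))"

definition P1_top :: "P1 topology" where
  "P1_top = pullback_topology UNIV cayley (subtopology euclidean (sphere 0 1))"

definition infty :: P1 where "infty = None"

text \<open>Matrices (a,b,c,d) = [[a,b],[c,d]] acting by projective transformations
  [x:y] \<mapsto> [a x + b y : c x + d y].\<close>

definition mob :: "real \<times> real \<times> real \<times> real \<Rightarrow> P1 \<Rightarrow> P1" where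
  "mob M p = (case M of (a,b,c,d) \<Rightarrow>
     (case p of None \<Rightarrow> (if c = 0 then None else Some (a / c))
      | Some t \<Rightarrow> (if c * t + d = 0 then None else Some ((a * t + b) / (c * t + d)))))"

definition SL2 :: "real set \<Rightarrow> (real \<times> real \<times> real \<times> real) set" where
  "SL2 A = {(a,b,c,d). a \<in> A \<and> b \<in> A \<and> c \<in> A \<and> d \<in> A \<and> a * d - b * c = 1}"

definition hyperbolic :: "real \<times> real \<times> real \<times> real \<Rightarrow> bool" where
  "hyperbolic M = (case M of (a,b,c,d) \<Rightarrow> \<bar>a + d\<bar> > 2)"

definition subring_real :: "real set \<Rightarrow> bool" where
  "subring_real A = (0 \<in> A \<and> 1 \<in> A \<and> (\<forall>x\<in>A. \<forall>y\<in>A. x + y \<in> A \<and> x - y \<in> A \<and> x * y \<in> A))"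

definition P_set :: "real set \<Rightarrow> P1 set" where
  "P_set A = {p. \<exists>M \<in> SL2 A. hyperbolic M \<and> mob M p = p}"

definition G_set :: "real set \<Rightarrow> (P1 \<Rightarrow> P1) set" where
  "G_set A = {f. homeomorphic_map P1_top P1_top f \<and>
     (\<exists>\<I>. finite \<I> \<and> \<Union>\<I> = UNIV \<and>
        (\<forall>I\<in>\<I>. connectedin P1_top I \<and> P1_top frontier_of I \<subseteq> P_set A \<and>
                 (\<exists>M\<in>SL2 A. \<forall>x\<in>I. f x = mob M x)))}"

definition H_set :: "real set \<Rightarrow> (P1 \<Rightarrow> P1) set" where
  "H_set A = {f \<in> G_set A. f infty = infty}"

definition H_grp :: "real set \<Rightarrow> (P1 \<Rightarrow> P1) monoid" where
  "H_grp A = \<lparr>carrier = H_set A, mult = (\<circ>), one = id\<rparr>"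

definition amenable :: "('g, 'z) monoid_scheme \<Rightarrow> bool" where
  "amenable G = (\<exists>\<mu> :: 'g set \<Rightarrow> real.
     (\<forall>X \<subseteq> carrier G. \<mu> X \<ge> 0) \<and>
     \<mu> (carrier G) = 1 \<and>
     (\<forall>X Y. X \<subseteq> carrier G \<longrightarrow> Y \<subseteq> carrier G \<longrightarrow> X \<inter> Y = {} \<longrightarrow>
        \<mu> (X \<union> Y) = \<mu> X + \<mu> Y) \<and>
     (\<forall>g \<in> carrier G. \<forall>X \<subseteq> carrier G. \<mu> ((\<lambda>x. g \<otimes>\<^bsub>G\<^esub> x) ` X) = \<mu> X))"

end

theory Submission
  imports Defs "HOL-Computational_Algebra.Polynomial_Factorial" "HOL-Computational_Algebra.Fundamental_Theorem_Algebra"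
begin

text \<open>
  Call \<open>s\<close> one of four letters, the generators \<open>a\<close>, \<open>b\<close> of a free group and their inverses.
  As \<open>A \<noteq> \<int>\<close>, there is \<open>x \<in> A\<close> with \<open>0 < x < 1\<close>; some power \<open>t\<close> of \<open>x\<close>, as small as we please,
  is not a root of any integer polynomial with leading coefficient \<open>\<plusminus>1\<close> all of whose complex roots
  have modulus less than 2. Indeed otherwise \<open>x\<close> would be an algebraic integer with all
  conjugates in the closed unit disc, so that its norm would be a nonzero integer of modulus less
  than 1. Substituting \<open>t\<close> into suitable matrices over the integer polynomials yields
  \<open>a, b \<in> SL2 A\<close> close to the identity that are free in \<open>PSL2\<close>.

  For \<open>h \<in> H_set A\<close> and almost every real \<open>x\<close>, the inverse of \<open>h\<close> is given near \<open>x\<close> by one element of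
  \<open>PSL2 A\<close>. Let \<open>m s h\<close> be the measure of the set of those \<open>x\<close> in the unit interval at which this
  element lies in \<open>W s\<close>, where the \<open>W s\<close> are the four disjoint pieces of the
  paradoxical decomposition. Thus the four numbers \<open>m s h\<close> have sum at most 1. Each generator
  agrees on the unit interval with some \<open>g \<in> H_set A\<close>, and since it nearly preserves the interval and
  its measure, \<open>m s (g \<circ> h)\<close> is at least about \<open>1 - m (s\<inverse>) h\<close>. Hence for an invariant mean \<open>\<mu>\<close> the sum over
  \<open>s\<close> of \<open>\<mu> {h. m (s\<inverse>) h > 2/5} + \<mu> {h. m s h > 1/2}\<close> is at least 4, whereas it is at most \<open>2 + 1\<close>.
\<close>

section \<open>Free pairs close to the identity\<close>

definition ieval :: "int poly \<Rightarrow> 'a::comm_ring_1 \<Rightarrow> 'a" where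
  "ieval p z = poly (map_poly of_int p) z"

lemma ieval_add: "ieval (p + q) z = ieval p z + ieval q z"
proof -
  have "map_poly of_int (p + q) = (map_poly of_int p + map_poly of_int q :: 'a poly)"
    by (rule poly_eqI) (simp add: coeff_map_poly)
  then show ?thesis by (simp add: ieval_def)
qed

lemma ieval_mult: "ieval (p * q) z = ieval p z * ieval q z"
proof -
  have "map_poly of_int (p * q) = (map_poly of_int p * map_poly of_int q :: 'a poly)"
    by (rule poly_eqI) (simp add: coeff_map_poly coeff_mult)
  then show ?thesis by (simp add: ieval_def)
qed

lemma ieval_const [simp]: "ieval [:c:] z = of_int c"
  by (simp add: ieval_def map_poly_pCons)

lemma ieval_0 [simp]: "ieval 0 z = 0" and ieval_1 [simp]: "ieval 1 z = 1"
  by (simp_all add: ieval_def)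

lemma ieval_pCons: "ieval (pCons c p) z = of_int c + z * ieval p z"
  by (cases "pCons c p = 0") (auto simp: ieval_def map_poly_pCons)

lemma ieval_smult: "ieval (smult c p) z = of_int c * ieval p z"
  using ieval_mult[of "[:c:]" p z] by simp

lemma ieval_minus: "ieval (- p) z = - ieval p z"
  using ieval_smult[of "-1" p z] by simp

lemma ieval_diff: "ieval (p - q) z = ieval p z - ieval q z"
  using ieval_add[of p "- q" z] by (simp add: ieval_minus)

lemma ieval_monom: "ieval (monom 1 n) z = z ^ n"
  by (simp add: ieval_def map_poly_monom poly_monom)

lemma ieval_pcompose: "ieval (pcompose p q) z = ieval p (ieval q z)"
  by (induction p) (simp_all add: pcompose_pCons ieval_add ieval_mult ieval_pCons)

lemma ieval_of_real: "ieval p (of_real x :: complex) = of_real (ieval p x)"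
  by (induction p) (simp_all add: ieval_pCons)

lemma ieval_primitive_part:
  fixes z :: "'a::{idom,ring_char_0}"
  assumes "p \<noteq> 0" "ieval p z = 0"
  shows "ieval (primitive_part p) z = 0"
proof -
  have "of_int (content p) * ieval (primitive_part p) z = 0"
    using assms(2) by (metis content_times_primitive_part ieval_smult)
  then show ?thesis using assms(1) by simp
qed

text \<open>Pseudo-division by \<open>m\<close> leaves a remainder that vanishes at \<open>x\<close>
  and has smaller degree, so it is 0 by minimality. The factor \<open>c\<close> is a power of the
  leading coefficient of \<open>m\<close>; it replaces a division over the rationals.\<close>

lemma minimal_int_poly_dvd:
  fixes x :: "'a::{idom,ring_char_0}"
  assumes m0: "m \<noteq> 0" and mx: "ieval m x = 0"
    and mn: "\<And>p. p \<noteq> 0 \<Longrightarrow> ieval p x = 0 \<Longrightarrow> degree m \<le> degree p"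
    and qx: "ieval q x = 0"
  obtains c s where "c \<noteq> 0" "smult c q = m * s"
proof -
  obtain s r where sr: "pseudo_divmod q m = (s, r)" by fastforce
  let ?c = "lead_coeff m ^ (Suc (degree q) - degree m)"
  have e: "smult ?c q = m * s + r" and d: "r = 0 \<or> degree r < degree m"
    using pseudo_divmod[OF m0 sr] by auto
  have "ieval r x = 0"
    using arg_cong[OF e, of "\<lambda>p. ieval p x"] by (simp add: ieval_add ieval_mult ieval_smult mx qx)
  then have "r = 0" using mn[of r] d by fastforce
  with e m0 show thesis by (intro that[of ?c s]) auto
qed

text \<open>The lower left entries of nonempty reduced words are polynomials of this kind. The
  radius 2 serves as follows: if \<open>z ^ n\<close> is a zero of such a polynomial, then
  \<open>z\<close> has modulus below the \<open>n\<close>-th root of 2, which tends to 1.\<close>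

definition unit_dominant :: "int poly \<Rightarrow> bool" where
  "unit_dominant q \<longleftrightarrow> \<bar>lead_coeff q\<bar> = 1 \<and> (\<forall>z::complex. norm z \<ge> 2 \<longrightarrow> ieval q z \<noteq> 0)"

text \<open>Up to a factor of modulus 1, the value at 0 is the product of the negated zeros; the
  zero \<open>x\<close> has modulus less than 1 and the others have modulus at most 1.\<close>

lemma norm_prod_roots_le:
  fixes p :: "complex poly"
  assumes p: "norm (lead_coeff p) = 1" and roots: "\<And>z. poly p z = 0 \<Longrightarrow> norm z \<le> 1"
    and x: "poly p x = 0" "norm x < 1"
  shows "norm (poly p 0) < 1"
proof -
  have p0: "p \<noteq> 0" using p by auto
  obtain B where "p = smult (lead_coeff p) (\<Prod>z\<in>#B. [:-z, 1:])"
    using alg_closed_imp_factorization[OF p0] by auto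
  then have "poly p w = poly (smult (lead_coeff p) (\<Prod>z\<in>#B. [:-z, 1:])) w" for w by simp
  then have pB: "poly p w = lead_coeff p * (\<Prod>z\<in>#B. w - z)" for w
    by (simp add: poly_prod_mset image_mset.compositionality comp_def)
  have l0: "lead_coeff p \<noteq> 0" using p0 by simp
  have xB: "x \<in># B" using x(1) pB[of x] l0 by auto
  have zB: "norm z \<le> 1" if "z \<in># B" for z
    by (rule roots) (use pB[of z] that in auto)
  have le1: "norm (\<Prod>z\<in>#C. 0 - z) \<le> 1" if "\<And>z. z \<in># C \<Longrightarrow> norm z \<le> 1" for C :: "complex multiset"
    using that
  proof (induction C)
    case (add a C)
    then have "norm a * norm (\<Prod>z\<in>#C. 0 - z) \<le> 1 * 1" by (intro mult_mono) auto
    then show ?case by (simp add: norm_mult)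
  qed simp
  obtain C where C: "B = add_mset x C" using xB by (metis insert_DiffM)
  have "norm (poly p 0) = norm x * norm (\<Prod>z\<in>#C. 0 - z)"
    by (simp add: pB C norm_mult p)
  also have "\<dots> \<le> norm x * 1" using zB by (intro mult_left_mono le1) (auto simp: C)
  finally show ?thesis using x(2) by simp
qed

text \<open>If all high powers of \<open>x\<close> were such zeros, Gauss's lemma would make the
  primitive minimal polynomial of \<open>x\<close> monic up to sign, and letting \<open>n\<close>
  grow would force its zeros into the closed unit disc. Its constant coefficient would then be too
  small for a nonzero integer.\<close>

lemma power_not_root_unit_dominant:
  fixes x :: real
  assumes x: "0 < x" "x < 1"
  shows "\<exists>n\<ge>N. \<forall>q. unit_dominant q \<longrightarrow> ieval q (x ^ n) \<noteq> 0"
proof (rule ccontr)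
  assume "\<not> ?thesis"
  then have "\<forall>n\<ge>N. \<exists>q. unit_dominant q \<and> ieval q (x ^ n) = 0" by auto
  then obtain q where q: "\<And>n. n \<ge> N \<Longrightarrow> unit_dominant (q n)" "\<And>n. n \<ge> N \<Longrightarrow> ieval (q n) (x ^ n) = 0"
    by metis
  define Q where "Q n = pcompose (q n) (monom 1 n)" for n
  have Qx: "ieval (Q n) x = 0" if "n \<ge> N" for n
    using q(2)[OF that] by (simp add: Q_def ieval_pcompose ieval_monom)
  have Ql: "\<bar>lead_coeff (Q n)\<bar> = 1" if "n \<ge> N" "n > 0" for n
    using q(1)[OF that(1)] that(2)
    by (simp add: Q_def lead_coeff_comp degree_monom_eq unit_dominant_def)
  \<comment> \<open>The exponent must be positive: substituting the constant
    \<open>monom 1 0\<close> would not preserve the leading coefficient.\<close>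
  define n0 where "n0 = max N 1"
  have n0: "n0 \<ge> N" "n0 > 0" by (auto simp: n0_def)
  have "Q n0 \<noteq> 0" using Ql[OF n0] by auto
  then obtain m0 where m0: "m0 \<noteq> 0" "ieval m0 x = 0"
    and m0_min: "\<And>p. p \<noteq> 0 \<Longrightarrow> ieval p x = 0 \<Longrightarrow> degree m0 \<le> degree p"
    using Qx[OF n0(1)] ex_has_least_nat[of "\<lambda>p. p \<noteq> 0 \<and> ieval p x = 0" _ degree] by blast
  define m where "m = primitive_part m0"
  have m: "m \<noteq> 0" "ieval m x = 0" "content m = 1" "degree m = degree m0"
    using m0 ieval_primitive_part[OF m0] by (auto simp: m_def)
  have m_min: "degree m \<le> degree p" if "p \<noteq> 0" "ieval p x = 0" for p
    using m0_min[OF that] m(4) by simp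
  obtain c s where cs: "c \<noteq> 0" "smult c (Q n0) = m * s"
    using minimal_int_poly_dvd[OF m(1,2) m_min Qx[OF n0(1)]] by metis
  \<comment> \<open>Gauss's lemma: as \<open>Q n0\<close> and \<open>m\<close> are both primitive,
    \<open>c\<close> is up to sign the content of \<open>s\<close> and cancels. So \<open>m\<close>
    divides \<open>Q n0\<close> over the integers and inherits a leading coefficient of absolute
    value 1.\<close>
  have cQ: "content (Q n0) = 1"
  proof -
    have "content (Q n0) dvd lead_coeff (Q n0)" by simp
    then have "content (Q n0) dvd 1" using Ql[OF n0] by (metis dvd_abs_iff)
    then show ?thesis using normalize_content[of "Q n0"] by (metis is_unit_normalize)
  qed
  have "normalize c * content (Q n0) = content m * content s"
    using arg_cong[OF cs(2), of content] by (simp add: content_mult)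
  then have "content s = \<bar>c\<bar>" using cQ m(3) by simp
  then have "c dvd content s" by simp
  then obtain s' where "s = smult c s'"
    by (metis content_times_primitive_part dvd_def smult_smult)
  with cs have "Q n0 = m * s'"
    by (metis mult_smult_right smult_cancel)
  then have "lead_coeff m dvd lead_coeff (Q n0)" by (simp add: lead_coeff_mult)
  then have ml: "\<bar>lead_coeff m\<bar> = 1" using Ql[OF n0]
    by (metis dvd_abs_iff zdvd1_eq)
  let ?M = "map_poly of_int m :: complex poly"
  have Mdeg: "degree ?M = degree m" by (rule map_poly_degree_eq) (use m(1) in auto)
  have Ml: "norm (lead_coeff ?M) = 1" unfolding Mdeg using ml
    by (simp add: coeff_map_poly)
  \<comment> \<open>A conjugate \<open>z\<close> outside the closed unit disc has a power
    \<open>z ^ n\<close> of modulus at least 2. As \<open>m\<close> divides a nonzero multiple of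
    \<open>Q n\<close>, this power would be a zero of \<open>q n\<close>.\<close>
  have roots: "norm z \<le> 1" if z: "poly ?M z = 0" for z
  proof (rule ccontr)
    assume "\<not> norm z \<le> 1"
    then obtain n1 where n1: "2 < norm z ^ n1" using real_arch_pow[of "norm z" 2] by auto
    define n where "n = max n1 n0"
    have "norm z ^ n1 \<le> norm z ^ n" by (rule power_increasing) (use \<open>\<not> norm z \<le> 1\<close> in \<open>auto simp: n_def\<close>)
    then have big: "norm (z ^ n) \<ge> 2" using n1 by (simp add: norm_power)
    have nN: "n \<ge> N" using n0 by (auto simp: n_def)
    obtain c s where cs: "c \<noteq> 0" "smult c (Q n) = m * s"
      using minimal_int_poly_dvd[OF m(1,2) m_min Qx[OF nN]] by metis
    have "ieval m z = 0" using z by (simp add: ieval_def)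
    then have "ieval (Q n) z = 0"
      using arg_cong[OF cs(2), of "\<lambda>p. ieval p z"] cs(1) by (simp add: ieval_mult ieval_smult)
    then have "ieval (q n) (z ^ n) = 0" by (simp add: Q_def ieval_pcompose ieval_monom)
    then show False using q(1)[OF nN] big by (auto simp: unit_dominant_def)
  qed
  have "poly ?M (of_real x) = 0" using m(2) ieval_of_real[of m x] by (simp add: ieval_def)
  then have "norm (poly ?M 0) < 1" using norm_prod_roots_le[OF Ml roots] x by simp
  \<comment> \<open>The constant coefficient is an integer of modulus less than 1. Once it is 0,
    cancelling the variable yields a polynomial of smaller degree that still vanishes at
    \<open>x\<close>.\<close>
  then have "coeff m 0 = 0"
    by (simp add: poly_0_coeff_0 coeff_map_poly)
  then obtain m' where m': "m = pCons 0 m'" by (metis coeff_pCons_0 pCons_cases)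
  then have "m' \<noteq> 0" "ieval m' x = 0" using m x by (auto simp: ieval_pCons)
  then show False using m_min[of m'] m' by simp
qed

text \<open>Models two consecutive continuants, as they occur in the bottom row of a product of
  elementary matrices.\<close>

definition continuants :: "int poly \<Rightarrow> int poly \<Rightarrow> bool" where
  "continuants p q \<longleftrightarrow> degree q < degree p \<and> \<bar>lead_coeff p\<bar> = 1 \<and>
     (\<forall>z::complex. norm z \<ge> 2 \<longrightarrow> norm (ieval q z) \<le> norm (ieval p z) \<and> ieval p z \<noteq> 0)"

text \<open>For \<open>norm z \<ge> 2\<close> the new value has modulus at least twice that of
  \<open>p\<close> minus that of \<open>q\<close>, hence at least that of \<open>p\<close>. The
  leading term is the product of those of \<open>y\<close> and \<open>p\<close>, because
  \<open>q\<close> has smaller degree.\<close>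

lemma continuants_step:
  assumes pq: "continuants p q" and y: "degree y > 0" "\<bar>lead_coeff y\<bar> = 1"
    "\<And>z::complex. norm z \<ge> 2 \<Longrightarrow> norm (ieval y z) \<ge> 2"
  shows "continuants (y * p + q) p"
proof -
  have y0: "y \<noteq> 0" and p0: "p \<noteq> 0" using y pq by (auto simp: continuants_def)
  have d: "degree (y * p) = degree y + degree p" using y0 p0 by (rule degree_mult_eq)
  have lt: "degree q < degree (y * p)" using pq d by (auto simp: continuants_def)
  then have d': "degree (y * p + q) = degree y + degree p" by (simp add: degree_add_eq_left d)
  have "coeff q (degree y + degree p) = 0" using lt d by (intro coeff_eq_0) simp
  then have l: "lead_coeff (y * p + q) = lead_coeff y * lead_coeff p"
    unfolding d' by (simp add: coeff_mult_degree_sum)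
  have "norm (ieval p z) \<le> norm (ieval (y * p + q) z) \<and> ieval (y * p + q) z \<noteq> 0"
    if z: "norm z \<ge> 2" for z :: complex
  proof -
    have a: "norm (ieval q z) \<le> norm (ieval p z)" "ieval p z \<noteq> 0"
      using pq z by (auto simp: continuants_def)
    have "2 * norm (ieval p z) \<le> norm (ieval y z * ieval p z)"
      using y(3)[OF z] by (simp add: norm_mult mult_right_mono)
    also have "\<dots> \<le> norm (ieval (y * p + q) z) + norm (ieval q z)"
      by (simp add: ieval_add ieval_mult) (metis add_diff_cancel norm_triangle_ineq4)
    finally have "2 * norm (ieval p z) \<le> norm (ieval (y * p + q) z) + norm (ieval q z)" .
    moreover have "norm (ieval p z) > 0" using a by simp
    ultimately show ?thesis using a(1) by (intro conjI) force+
  qed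
  with d' l y pq show ?thesis by (auto simp: continuants_def abs_mult)
qed

lemma continuants_unit_dominant: "continuants p q \<Longrightarrow> unit_dominant p"
  by (simp add: continuants_def unit_dominant_def)

section \<open>Letters, words and their matrices\<close>

type_synonym mat2 = "real \<times> real \<times> real \<times> real"

fun mmul :: "mat2 \<Rightarrow> mat2 \<Rightarrow> mat2" where
  "mmul (a,b,c,d) (a',b',c',d') = (a*a' + b*c', a*b' + b*d', c*a' + d*c', c*b' + d*d')"

text \<open>The first component selects the generator; the second is \<open>False\<close> for its
  inverse.\<close>

type_synonym letter = "bool \<times> bool"

fun inv_letter :: "letter \<Rightarrow> letter" where
  "inv_letter (g, b) = (g, \<not> b)"

text \<open>The four letters receive the four distinct exponents 1 to 4, so that the powers of
  \<open>t\<close> belonging to different letters never cancel.\<close>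

fun letter_exp :: "letter \<Rightarrow> nat" where
  "letter_exp (g, b) = (if g then 3 else 1) + (if b then 0 else 1)"

fun letter_sgn :: "letter \<Rightarrow> int" where
  "letter_sgn (g, b) = (if b then 1 else - 1)"

lemma inv_letter_inv_letter [simp]: "inv_letter (inv_letter s) = s"
  by (cases s) simp

lemma letter_exp_pos: "letter_exp s > 0"
  by (cases s) simp

lemma letter_exp_inj: "letter_exp s = letter_exp t \<Longrightarrow> s = t"
  by (cases s; cases t) (auto split: if_splits)

lemma letter_sgn_inv [simp]: "letter_sgn (inv_letter s) = - letter_sgn s"
  by (cases s) simp

lemma abs_letter_sgn [simp]: "\<bar>letter_sgn s\<bar> = 1"
  by (cases s) simp

text \<open>With \<open>u y = [[1,y],[0,1]]\<close> and \<open>l y = [[1,0],[y,1]]\<close> this is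
  \<open>u (t^e) * l (\<plusminus>t) * u (- t^e')\<close>. In a reduced word, adjacent upper unipotent factors
  merge to \<open>u (t^e - t^e')\<close> with \<open>e \<noteq> e'\<close>, a polynomial with leading coefficient \<open>\<plusminus>1\<close>.\<close>

definition gen_mat :: "real \<Rightarrow> letter \<Rightarrow> mat2" where
  "gen_mat t s = (let p = t ^ letter_exp s; q = t ^ letter_exp (inv_letter s); x = of_int (letter_sgn s) * t
     in (1 + p * x, p - q * (1 + p * x), x, 1 - x * q))"

definition word_mat :: "real \<Rightarrow> letter list \<Rightarrow> mat2" where
  "word_mat t w = foldl (\<lambda>M s. mmul M (gen_mat t s)) (1,0,0,1) w"

definition reduced :: "letter list \<Rightarrow> bool" where
  "reduced w \<longleftrightarrow> successively (\<lambda>s t. t \<noteq> inv_letter s) w"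

text \<open>For \<open>k > l\<close> write \<open>z ^ k - z ^ l\<close> as
  \<open>z ^ l * (z ^ (k - l) - 1)\<close>; the factors have modulus at least 2 and 1. The case
  \<open>i < j\<close> differs by a sign only.\<close>

lemma monom_diff_dominant:
  assumes "i > 0" "j > 0" "i \<noteq> (j::nat)"
  defines "y \<equiv> monom (1::int) i - monom 1 j"
  shows "degree y > 0" "\<bar>lead_coeff y\<bar> = 1" "\<And>z::complex. norm z \<ge> 2 \<Longrightarrow> norm (ieval y z) \<ge> 2"
proof -
  have gt: "degree (monom (1::int) k - monom 1 l) = k \<and> lead_coeff (monom (1::int) k - monom 1 l) = 1
    \<and> (\<forall>z::complex. norm z \<ge> 2 \<longrightarrow> norm (ieval (monom 1 k - monom 1 l) z) \<ge> 2)"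
    if kl: "k > l" "l > 0" for k l
  proof -
    have d: "degree (monom (1::int) k - monom 1 l) = k"
      using degree_add_eq_left[of "- monom (1::int) l" "monom 1 k"] kl by (simp add: degree_monom_eq)
    have "2 \<le> norm (z ^ k - z ^ l)" if z: "norm z \<ge> 2" for z :: complex
    proof -
      have pow: "norm z ^ m \<ge> 2" if "m > 0" for m
        using power_increasing[of 1 m "norm z"] that z by simp
      have "z ^ k - z ^ l = z ^ l * (z ^ (k - l) - 1)"
        using kl by (simp add: algebra_simps flip: power_add)
      then have "norm (z ^ k - z ^ l) = norm z ^ l * norm (z ^ (k - l) - 1)"
        by (simp add: norm_mult norm_power)
      moreover have "norm (z ^ (k - l) - 1) \<ge> 1"
        using norm_triangle_ineq2[of "z ^ (k - l)" 1] pow[of "k - l"] kl by (simp add: norm_power)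
      ultimately show ?thesis using pow[of l] kl mult_mono[of 2 "norm z ^ l" 1 "norm (z ^ (k - l) - 1)"] by simp
    qed
    then show ?thesis using kl by (simp add: d ieval_diff ieval_monom)
  qed
  have "y = - (monom 1 j - monom 1 i)" by (simp add: y_def)
  then have "degree y > 0 \<and> \<bar>lead_coeff y\<bar> = 1 \<and> (\<forall>z::complex. norm z \<ge> 2 \<longrightarrow> norm (ieval y z) \<ge> 2)"
  proof (cases "i > j")
    case True
    then show ?thesis using gt[of j i] assms by (simp add: y_def)
  next
    case False
    then have g: "j > i" using assms by simp
    have "degree y = j" "lead_coeff y = -1" "norm (ieval y z) = norm (ieval (monom 1 j - monom 1 i) z)" for z :: complex
      using gt[OF g assms(1)] \<open>y = _\<close> by (metis degree_minus, metis lead_coeff_minus, metis ieval_minus norm_minus_cancel)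
    then show ?thesis using gt[OF g assms(1)] assms(2) by simp
  qed
  then show "degree y > 0" "\<bar>lead_coeff y\<bar> = 1" "\<And>z::complex. norm z \<ge> 2 \<Longrightarrow> norm (ieval y z) \<ge> 2"
    by auto
qed

text \<open>\<open>(C, D)\<close> is the bottom row before the last upper unipotent factor is
  applied. Appending a letter turns it first into \<open>(C, y * C + D)\<close>, where
  \<open>y\<close> comes from the two merged upper factors, and then into
  \<open>(X * (y * C + D) + C, y * C + D)\<close> by the lower factor. These are two continuant
  steps; reducedness ensures that the exponents in \<open>y\<close> differ.\<close>

lemma word_mat_bottom_row:
  assumes "reduced w" "w \<noteq> []"
  shows "\<exists>C D a b. continuants C D \<and> word_mat t w =
     (a, b, ieval C t, ieval D t - ieval C t * t ^ letter_exp (inv_letter (last w)))"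
  using assms
proof (induction w rule: rev_induct)
  case (snoc s w)
  define X where "X = [:0, letter_sgn s:]"
  have Xt: "ieval X z = of_int (letter_sgn s) * z" for z :: "'a::comm_ring_1"
    by (simp add: X_def ieval_pCons)
  have "letter_sgn s \<noteq> 0" using abs_letter_sgn[of s] by linarith
  then have X: "degree X > 0" "\<bar>lead_coeff X\<bar> = 1" "\<And>z::complex. norm z \<ge> 2 \<Longrightarrow> norm (ieval X z) \<ge> 2"
    by (simp_all add: X_def ieval_pCons norm_mult flip: of_int_abs)
  show ?case
  proof (cases "w = []")
    case True
    have "1 \<le> norm (ieval X z)" "ieval X z \<noteq> 0" if "norm z \<ge> 2" for z :: complex
      using X(3)[OF that] by auto
    then have "continuants X 1" using X by (auto simp: continuants_def)
    moreover have "\<exists>a b. word_mat t (w @ [s]) =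
        (a, b, ieval X t, ieval 1 t - ieval X t * t ^ letter_exp (inv_letter (last (w @ [s]))))"
      by (simp add: True word_mat_def gen_mat_def Let_def Xt)
    ultimately show ?thesis by blast
  next
    case False
    have "reduced w" and ne: "s \<noteq> inv_letter (last w)"
      using snoc.prems False by (simp_all add: reduced_def successively_append_iff)
    then obtain C D a b where CD: "continuants C D"
      "word_mat t w = (a, b, ieval C t, ieval D t - ieval C t * t ^ letter_exp (inv_letter (last w)))"
      using snoc.IH False by blast
    define y where "y = monom (1::int) (letter_exp s) - monom 1 (letter_exp (inv_letter (last w)))"
    have "letter_exp s \<noteq> letter_exp (inv_letter (last w))" using ne letter_exp_inj by blast
    note y = monom_diff_dominant[OF letter_exp_pos letter_exp_pos this, folded y_def]
    have "continuants (y * C + D) C" using continuants_step[OF CD(1)] y by blast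
    then have "continuants (X * (y * C + D) + C) (y * C + D)" using continuants_step X by blast
    moreover have "\<exists>a b. word_mat t (w @ [s]) = (a, b, ieval (X * (y * C + D) + C) t,
        ieval (y * C + D) t - ieval (X * (y * C + D) + C) t * t ^ letter_exp (inv_letter (last (w @ [s]))))"
      using CD(2)
      by (simp add: word_mat_def gen_mat_def Let_def ieval_add ieval_mult Xt y_def ieval_diff ieval_monom)
         (simp add: algebra_simps)
    ultimately show ?thesis by blast
  qed
qed simp

lemma word_mat_lower_left:
  assumes "reduced w" "w \<noteq> []" "\<And>q. unit_dominant q \<Longrightarrow> ieval q t \<noteq> 0" "word_mat t w = (a,b,c,d)"
  shows "c \<noteq> 0"
proof -
  obtain C D where C: "continuants C D" and c: "c = ieval C t"
    using word_mat_bottom_row[OF assms(1,2), of t] assms(4) by auto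
  show ?thesis unfolding c by (rule assms(3)[OF continuants_unit_dominant[OF C]])
qed

section \<open>The topology of the projective line\<close>

lemma cayley_Some_neq_1: "cayley (Some t) \<noteq> 1"
proof
  assume "cayley (Some t) = 1"
  moreover have "complex_of_real t + \<i> \<noteq> 0" by (simp add: complex_eq_iff)
  ultimately show False by (simp add: cayley_def divide_eq_eq)
qed

lemma norm_cayley: "norm (cayley p) = 1"
proof (cases p)
  case (Some t)
  have "complex_of_real t + \<i> \<noteq> 0" by (simp add: complex_eq_iff)
  moreover have "norm (complex_of_real t - \<i>) = norm (complex_of_real t + \<i>)"
    by (simp add: cmod_def)
  ultimately show ?thesis by (simp add: cayley_def Some norm_divide)
qed (simp add: cayley_def)

lemma inverse_cayley: "\<i> * (1 + cayley (Some t)) / (1 - cayley (Some t)) = complex_of_real t"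
proof -
  have z: "complex_of_real t + \<i> \<noteq> 0" by (simp add: complex_eq_iff)
  have 1: "1 + cayley (Some t) = 2 * complex_of_real t / (complex_of_real t + \<i>)"
    using z by (simp add: cayley_def field_simps)
  have 2: "1 - cayley (Some t) = 2 * \<i> / (complex_of_real t + \<i>)"
    using z by (simp add: cayley_def field_simps)
  show ?thesis unfolding 1 2 using z by simp
qed

text \<open>As \<open>norm (t + \<i>)\<close> lies between \<open>\<bar>t\<bar>\<close> and
  \<open>\<bar>t\<bar> + 1\<close>, this matches small discs about 1 with complements of bounded
  sets of reals.\<close>

lemma dist_cayley_1: "norm (cayley (Some t) - 1) = 2 / norm (complex_of_real t + \<i>)"
proof -
  have z: "complex_of_real t + \<i> \<noteq> 0" by (simp add: complex_eq_iff)
  then have "cayley (Some t) - 1 = - 2 * \<i> / (complex_of_real t + \<i>)"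
    by (simp add: cayley_def field_simps)
  then show ?thesis by (simp add: norm_divide norm_mult)
qed

lemma topspace_P1 [simp]: "topspace P1_top = UNIV"
  by (auto simp: P1_top_def topspace_pullback_topology norm_cayley)

lemma openin_P1_raw: "openin P1_top U \<longleftrightarrow> (\<exists>V. open V \<and> U = cayley -` V)"
proof -
  have 1: "cayley -` (V \<inter> sphere 0 1) = cayley -` V" for V
    by (auto simp: norm_cayley)
  have "openin P1_top U \<longleftrightarrow> (\<exists>V. open V \<and> U = cayley -` (V \<inter> sphere 0 1))"
    unfolding P1_top_def openin_pullback_topology openin_subtopology by auto
  then show ?thesis unfolding 1 .
qed

text \<open>This identifies the projective line with the one-point compactification of the real
  line. From here on the topology is handled without the Cayley transform.\<close>

lemma openin_P1:
  "openin P1_top U \<longleftrightarrow> open {t. Some t \<in> U} \<and> (None \<in> U \<longrightarrow> (\<exists>R. \<forall>t. \<bar>t\<bar> > R \<longrightarrow> Some t \<in> U))"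
proof
  assume "openin P1_top U"
  then obtain V where V: "open V" "U = cayley -` V" by (auto simp: openin_P1_raw)
  have "continuous_on UNIV (\<lambda>t::real. cayley (Some t))"
    by (auto simp: cayley_def complex_eq_iff intro!: continuous_intros)
  then have "open ((\<lambda>t. cayley (Some t)) -` V)" using V(1) by (rule open_vimage[rotated])
  moreover have "\<exists>R. \<forall>t. \<bar>t\<bar> > R \<longrightarrow> Some t \<in> U" if N: "None \<in> U"
  proof -
    have "1 \<in> V" using N V by (simp add: cayley_def)
    then obtain e where e: "e > 0" "ball 1 e \<subseteq> V" using V(1) open_contains_ball by blast
    have "Some t \<in> U" if t: "\<bar>t\<bar> > 2 / e" for t
    proof -
      have "\<bar>t\<bar> \<le> norm (complex_of_real t + \<i>)"
        using abs_Re_le_cmod[of "complex_of_real t + \<i>"] by simp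
      then have big: "2 / e < norm (complex_of_real t + \<i>)" using t by linarith
      then have "norm (complex_of_real t + \<i>) > 0"
        using e(1) by (smt (verit) divide_pos_pos)
      with big e(1) have "norm (cayley (Some t) - 1) < e"
        by (simp add: dist_cayley_1 field_simps)
      then show ?thesis using e(2) V(2) by (auto simp: dist_norm norm_minus_commute)
    qed
    then show ?thesis by blast
  qed
  ultimately show "open {t. Some t \<in> U} \<and> (None \<in> U \<longrightarrow> (\<exists>R. \<forall>t. \<bar>t\<bar> > R \<longrightarrow> Some t \<in> U))"
    using V(2) by (auto simp: vimage_def)
next
  assume *: "open {t. Some t \<in> U} \<and> (None \<in> U \<longrightarrow> (\<exists>R. \<forall>t. \<bar>t\<bar> > R \<longrightarrow> Some t \<in> U))"
  define S where "S = {t. Some t \<in> U}"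
  \<comment> \<open>The real part of the inverse Cayley transform, continuous on the plane without
    1. The preimage of \<open>S\<close> is the plane open set that cuts out the real part of
    \<open>U\<close>.\<close>
  define g where "g = (\<lambda>z::complex. Re (\<i> * (1 + z) / (1 - z)))"
  have "continuous_on (- {1}) g" by (auto simp: g_def intro!: continuous_intros)
  then have "open (- {1} \<inter> g -` S)"
    by (intro continuous_open_preimage) (use * in \<open>auto simp: S_def\<close>)
  moreover have gS: "Some t \<in> U \<longleftrightarrow> cayley (Some t) \<in> - {1} \<inter> g -` S" for t
    by (simp add: g_def S_def inverse_cayley cayley_Some_neq_1 del: times_divide_eq_right)
  moreover have "cayley None = 1" by (simp add: cayley_def)
  ultimately show "openin P1_top U"
  proof (cases "None \<in> U")
    case True
    then obtain R where R: "\<And>t. \<bar>t\<bar> > R \<Longrightarrow> Some t \<in> U" using * by blast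
    \<comment> \<open>The disc of radius \<open>e\<close> about 1 contains the images of real
      \<open>t\<close> only if \<open>\<bar>t\<bar> > \<bar>R\<bar>\<close>, because
      \<open>norm (t + \<i>)\<close> is at most \<open>\<bar>t\<bar> + 1\<close>.\<close>
    define e where "e = 2 / (\<bar>R\<bar> + 1)"
    have e0: "e > 0" by (simp add: e_def)
    have near: "Some t \<in> U" if "cayley (Some t) \<in> ball 1 e" for t
    proof (rule R)
      have z: "norm (complex_of_real t + \<i>) > 0" by (simp add: complex_eq_iff)
      have "2 / norm (complex_of_real t + \<i>) < e"
        using that by (simp add: dist_norm norm_minus_commute flip: dist_cayley_1)
      then have "\<bar>R\<bar> + 1 < norm (complex_of_real t + \<i>)" using z by (simp add: e_def field_simps)
      also have "\<dots> \<le> \<bar>t\<bar> + 1" using norm_triangle_ineq[of "complex_of_real t" "\<i>"] by simp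
      finally show "\<bar>t\<bar> > R" by simp
    qed
    have "p \<in> U \<longleftrightarrow> p \<in> cayley -` ((- {1} \<inter> g -` S) \<union> ball 1 e)" for p
    proof (cases p)
      case None
      then show ?thesis using True e0 \<open>cayley None = 1\<close> by simp
    next
      case (Some t)
      then show ?thesis using gS[of t] near[of t] by blast
    qed
    then have "U = cayley -` ((- {1} \<inter> g -` S) \<union> ball 1 e)" by blast
    then show ?thesis using \<open>open (- {1} \<inter> g -` S)\<close> unfolding openin_P1_raw
      by (intro exI[of _ "(- {1} \<inter> g -` S) \<union> ball 1 e"] conjI open_Un open_ball)
  next
    case False
    have "p \<in> U \<longleftrightarrow> p \<in> cayley -` (- {1} \<inter> g -` S)" for p
    proof (cases p)
      case None
      then show ?thesis using False \<open>cayley None = 1\<close> by simp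
    next
      case (Some t)
      then show ?thesis using gS[of t] by blast
    qed
    then have "U = cayley -` (- {1} \<inter> g -` S)" by blast
    then show ?thesis using \<open>open (- {1} \<inter> g -` S)\<close> unfolding openin_P1_raw
      by (intro exI[of _ "- {1} \<inter> g -` S"] conjI)
  qed
qed

section \<open>Intervals and connected sets of the projective line\<close>

lemma openin_P1_Some: "openin P1_top (Some ` S) \<longleftrightarrow> open S"
proof -
  have "{t. Some t \<in> Some ` S} = S" by auto
  then show ?thesis by (auto simp: openin_P1)
qed

lemma continuous_map_Some: "continuous_map euclidean P1_top Some"
  by (auto simp: continuous_map_def openin_P1)

lemma connectedin_Some: "is_interval S \<Longrightarrow> connectedin P1_top (Some ` S)"
  by (rule connectedin_continuous_map_image[OF continuous_map_Some])
     (simp add: is_interval_connected_1)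

text \<open>Infinity lies in the closure of an unbounded set of reals, and adding points of the
  closure keeps a set connected.\<close>

lemma connectedin_insert_None:
  assumes S: "is_interval S" and unb: "\<And>R. \<exists>t\<in>S. \<bar>t\<bar> > R"
  shows "connectedin P1_top (insert None (Some ` S))"
proof (rule connectedin_intermediate_closure_of[OF connectedin_Some[OF S]])
  have "None \<in> P1_top closure_of (Some ` S)"
    using unb by (simp add: in_closure_of openin_P1) (metis imageI)
  then show "insert None (Some ` S) \<subseteq> P1_top closure_of Some ` S"
    using closure_of_subset[of "Some ` S" P1_top] by auto
qed auto

text \<open>Of three frontier points the middle one would lie strictly between two points of the
  interval and so be interior. Hence there are at most two.\<close>

lemma finite_frontier_interval:
  assumes "is_interval (S :: real set)"
  shows "finite (frontier S)"
proof (rule ccontr)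
  have no3: False if abc: "a \<in> frontier S" "b \<in> frontier S" "c \<in> frontier S" "a < b" "b < c" for a b c
  proof -
    have "a \<in> closure S" "c \<in> closure S" "b - a > 0" "c - b > 0"
      using abc by (auto simp: frontier_def)
    then obtain a' c' where "a' \<in> S" "dist a' a < b - a" "c' \<in> S" "dist c' c < c - b"
      unfolding closure_approachable by meson
    then have a': "a' \<in> S" "a' < b" and c': "c' \<in> S" "b < c'"
      by (auto simp: dist_real_def abs_less_iff)
    have "{a'<..<c'} \<subseteq> S"
    proof
      fix x assume "x \<in> {a'<..<c'}"
      then show "x \<in> S" using mem_is_interval_1_I[OF assms a'(1) c'(1), of x] by simp
    qed
    then have "b \<in> interior S" using a' c' by (intro interiorI[of "{a'<..<c'}"]) simp_all
    then show False using abc by (simp add: frontier_def)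
  qed
  assume "infinite (frontier S)"
  then obtain T where T: "T \<subseteq> frontier S" "card T = 3" using infinite_arbitrarily_large by blast
  then obtain x y z where "T = {x, y, z}" "x \<noteq> y" "x \<noteq> z" "y \<noteq> z" by (auto simp: card_3_iff)
  then show False using no3 T(1) by (metis insert_subset linorder_neqE)
qed

text \<open>Without infinity, a missing point between two points of \<open>I\<close> would separate
  them. If infinity belongs to \<open>I\<close>, two missing points separate each point between them
  from infinity, so it is the complement that is an interval.\<close>

lemma connectedin_P1_interval:
  assumes I: "connectedin P1_top I"
  shows "is_interval {t. Some t \<in> I} \<or> is_interval (- {t. Some t \<in> I})"
proof -
  have sep: False if "openin P1_top U" "openin P1_top V" "I \<subseteq> U \<union> V" "U \<inter> V \<inter> I = {}" "U \<inter> I \<noteq> {}" "V \<inter> I \<noteq> {}" for U V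
    using I that unfolding connectedin by blast
  show ?thesis
  proof (cases "None \<in> I")
    case True
    have inner: "c \<notin> {t. Some t \<in> I}" if "a \<notin> {t. Some t \<in> I}" "b \<notin> {t. Some t \<in> I}" "a \<le> c" "c \<le> b" for a b c
    proof
      assume c: "c \<in> {t. Some t \<in> I}"
      have "{t. Some t \<in> - Some ` {a..b}} = - {a..b}" by auto
      moreover have "\<forall>t. \<bar>t\<bar> > max \<bar>a\<bar> \<bar>b\<bar> \<longrightarrow> Some t \<in> - Some ` {a..b}" by auto
      ultimately have o: "openin P1_top (- Some ` {a..b})" unfolding openin_P1
        by (metis closed_atLeastAtMost open_Compl)
      have "openin P1_top (Some ` {a<..<b})" by (simp add: openin_P1_Some)
      moreover have "I \<subseteq> Some ` {a<..<b} \<union> - Some ` {a..b}"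
      proof
        fix p assume "p \<in> I"
        then show "p \<in> Some ` {a<..<b} \<union> - Some ` {a..b}"
        proof (cases p)
          case (Some t)
          with \<open>p \<in> I\<close> that have "t \<noteq> a" "t \<noteq> b" by blast+
          then have "t \<in> {a<..<b} \<or> t \<notin> {a..b}" by auto
          then show ?thesis unfolding Some by blast
        qed simp
      qed
      moreover have "c \<noteq> a" "c \<noteq> b" using that c by blast+
      moreover have "Some ` {a<..<b} \<inter> - Some ` {a..b} \<inter> I = {}" by auto
      moreover have "Some c \<in> Some ` {a<..<b} \<inter> I" "None \<in> - Some ` {a..b} \<inter> I"
        using \<open>c \<noteq> a\<close> \<open>c \<noteq> b\<close> that(3,4) c True by (simp_all add: image_iff order.strict_iff_order)
      ultimately show False using sep[of "Some ` {a<..<b}" "- Some ` {a..b}"] o by blast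
    qed
    have "is_interval (- {t. Some t \<in> I})"
      unfolding is_interval_1 by (intro ballI allI impI) (use inner in blast)
    then show ?thesis ..
  next
    case False
    have inner: "c \<in> {t. Some t \<in> I}" if "a \<in> {t. Some t \<in> I}" "b \<in> {t. Some t \<in> I}" "a \<le> c" "c \<le> b" for a b c
    proof (rule ccontr)
      assume c: "c \<notin> {t. Some t \<in> I}"
      have "I \<subseteq> Some ` {..<c} \<union> Some ` {c<..}"
      proof
        fix p assume "p \<in> I"
        with False obtain t where t: "p = Some t" by (cases p) auto
        with c \<open>p \<in> I\<close> have "t \<noteq> c" by blast
        then have "t < c \<or> c < t" by (rule neq_iff[THEN iffD1])
        then show "p \<in> Some ` {..<c} \<union> Some ` {c<..}" by (auto simp: t)
      qed
      moreover have "c \<noteq> a" "c \<noteq> b" using that c by blast+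
      moreover have "Some ` {..<c} \<inter> Some ` {c<..} \<inter> I = {}" by auto
      moreover have "Some a \<in> Some ` {..<c} \<inter> I" "Some b \<in> Some ` {c<..} \<inter> I"
        using \<open>c \<noteq> a\<close> \<open>c \<noteq> b\<close> that by (simp_all add: image_iff order.strict_iff_order)
      moreover have "openin P1_top (Some ` {..<c})" "openin P1_top (Some ` {c<..})"
        by (simp_all add: openin_P1_Some)
      ultimately show False using sep[of "Some ` {..<c}" "Some ` {c<..}"] by blast
    qed
    have "is_interval {t. Some t \<in> I}"
      unfolding is_interval_1 by (intro ballI allI impI) (use inner in blast)
    then show ?thesis ..
  qed
qed

text \<open>A real frontier point is a frontier point of the trace of \<open>I\<close> on the real
  line, and infinity adds at most one more.\<close>

lemma finite_frontier_connectedin_P1: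
  assumes I: "connectedin P1_top I"
  shows "finite (P1_top frontier_of I)"
proof -
  let ?S = "{t. Some t \<in> I}"
  have "finite (frontier ?S)"
    using connectedin_P1_interval[OF I] finite_frontier_interval frontier_complement by metis
  moreover have fr: "t \<in> frontier ?S" if "Some t \<in> P1_top frontier_of I" for t
  proof -
    have c: "Some t \<in> P1_top closure_of I" "Some t \<notin> P1_top interior_of I"
      using that by (auto simp: frontier_of_def)
    have "t \<notin> interior ?S"
    proof
      assume "t \<in> interior ?S"
      then have "Some t \<in> Some ` interior ?S" "openin P1_top (Some ` interior ?S)" "Some ` interior ?S \<subseteq> I"
        using interior_subset by (auto simp: openin_P1_Some)
      then show False using c(2) by (meson interior_of_maximal subsetD)
    qed
    moreover have "t \<in> closure ?S"
    proof (rule ccontr)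
      assume "t \<notin> closure ?S"
      then have "Some t \<in> Some ` (- closure ?S)" "openin P1_top (Some ` (- closure ?S))"
        by (auto simp: openin_P1_Some)
      then obtain p where "p \<in> I" "p \<in> Some ` (- closure ?S)" using c(1) unfolding in_closure_of by meson
      then show False using closure_subset[of ?S] by auto
    qed
    ultimately show ?thesis by (simp add: frontier_def)
  qed
  moreover have "P1_top frontier_of I \<subseteq> insert None (Some ` frontier ?S)"
  proof (intro subsetI)
    fix p assume "p \<in> P1_top frontier_of I"
    then show "p \<in> insert None (Some ` frontier ?S)"
      by (cases p) (use fr in auto)
  qed
  ultimately have "finite (insert None (Some ` frontier ?S))" "P1_top frontier_of I \<subseteq> insert None (Some ` frontier ?S)"
    by auto
  then show ?thesis by (rule finite_subset[rotated])
qed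

section \<open>Projective and piecewise projective maps\<close>

fun minv :: "mat2 \<Rightarrow> mat2" where
  "minv (a,b,c,d) = (d, -b, -c, a)"

lemma mob_Some: "mob (a,b,c,d) (Some t) = (if c * t + d = 0 then None else Some ((a * t + b) / (c * t + d)))"
  and mob_None: "mob (a,b,c,d) None = (if c = 0 then None else Some (a / c))"
  by (simp_all add: mob_def)

lemma SL2_iff: "(a,b,c,d) \<in> SL2 A \<longleftrightarrow> a \<in> A \<and> b \<in> A \<and> c \<in> A \<and> d \<in> A \<and> a * d - b * c = 1"
  by (simp add: SL2_def)

lemma SL2_subset_UNIV: "M \<in> SL2 A \<Longrightarrow> M \<in> SL2 UNIV"
  by (cases M) (simp add: SL2_iff)

lemma subring_minus: "subring_real A \<Longrightarrow> x \<in> A \<Longrightarrow> - x \<in> A"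
  unfolding subring_real_def by (metis diff_0)

lemma SL2_mmul:
  assumes "subring_real A" "M \<in> SL2 A" "N \<in> SL2 A"
  shows "mmul M N \<in> SL2 A"
proof -
  obtain a b c d a' b' c' d' where [simp]: "M = (a,b,c,d)" "N = (a',b',c',d')"
    by (cases M; cases N) auto
  have "(a*a' + b*c') * (c*b' + d*d') - (a*b' + b*d') * (c*a' + d*c') = (a*d - b*c) * (a'*d' - b'*c')"
    by (simp add: algebra_simps)
  then show ?thesis using assms by (simp add: SL2_iff subring_real_def)
qed

lemma SL2_minv: "subring_real A \<Longrightarrow> M \<in> SL2 A \<Longrightarrow> minv M \<in> SL2 A"
  by (cases M) (auto simp: SL2_iff subring_minus algebra_simps)

lemma SL2_one: "subring_real A \<Longrightarrow> (1,0,0,1) \<in> SL2 A"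
  by (simp add: SL2_iff subring_real_def)

lemma subring_UNIV: "subring_real UNIV"
  by (simp add: subring_real_def)

lemma mob_one [simp]: "mob (1,0,0,1) = id"
proof
  fix p show "mob (1,0,0,1) p = id p" by (cases p) (simp_all add: mob_Some mob_None)
qed

text \<open>Determinant 1 keeps numerator and denominator from vanishing together, the one case in
  which the formula for the action makes no sense. The rest is a case distinction on where infinity
  occurs.\<close>

lemma mob_mmul:
  assumes "M \<in> SL2 A" "N \<in> SL2 B"
  shows "mob (mmul M N) = mob M \<circ> mob N"
proof
  fix p
  obtain a b c d a' b' c' d' where MN: "M = (a,b,c,d)" "N = (a',b',c',d')"
    by (cases M; cases N) auto
  have det: "a * d - b * c = 1" "a' * d' - b' * c' = 1" using assms by (auto simp: MN SL2_iff)
  show "mob (mmul M N) p = (mob M \<circ> mob N) p"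
  proof (cases p)
    case None
    show ?thesis
    proof (cases "c' = 0")
      case True
      then have "a' \<noteq> 0" using det by auto
      then show ?thesis by (simp add: MN None mob_None True)
    next
      case False
      have "c * (a' / c') + d = (c * a' + d * c') / c'" "a * (a' / c') + b = (a * a' + b * c') / c'"
        using False by (simp_all add: field_simps)
      then show ?thesis using False by (simp add: MN None mob_None mob_Some)
    qed
  next
    case (Some t)
    show ?thesis
    proof (cases "c' * t + d' = 0")
      case True
      have n: "a' * t + b' \<noteq> 0"
      proof
        assume "a' * t + b' = 0"
        then have "a' * (c' * t + d') - c' * (a' * t + b') = 0" using True by simp
        then show False using det(2) by (simp add: algebra_simps)
      qed
      have "(c * a' + d * c') * t + (c * b' + d * d') = c * (a' * t + b') + d * (c' * t + d')"
        "(a * a' + b * c') * t + (a * b' + b * d') = a * (a' * t + b') + b * (c' * t + d')"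
        by (simp_all add: algebra_simps)
      then show ?thesis using True n by (simp add: MN Some mob_Some mob_None)
    next
      case False
      let ?u = "(a' * t + b') / (c' * t + d')"
      have "c * ?u + d = ((c * a' + d * c') * t + (c * b' + d * d')) / (c' * t + d')"
        "a * ?u + b = ((a * a' + b * c') * t + (a * b' + b * d')) / (c' * t + d')"
        using False by (simp_all add: field_simps)
      then show ?thesis using False by (simp add: MN Some mob_Some)
    qed
  qed
qed

lemma mmul_minv: "M \<in> SL2 A \<Longrightarrow> mmul M (minv M) = (1,0,0,1)" "M \<in> SL2 A \<Longrightarrow> mmul (minv M) M = (1,0,0,1)"
  by (cases M; simp add: SL2_iff algebra_simps)+

lemma mob_minv:
  assumes "M \<in> SL2 A"
  shows "mob M \<circ> mob (minv M) = id" "mob (minv M) \<circ> mob M = id"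
proof -
  have M: "M \<in> SL2 UNIV" using assms by (rule SL2_subset_UNIV)
  have M': "minv M \<in> SL2 UNIV" using M by (rule SL2_minv[OF subring_UNIV])
  show "mob M \<circ> mob (minv M) = id" using mob_mmul[OF M M'] mmul_minv(1)[OF M] by simp
  show "mob (minv M) \<circ> mob M = id" using mob_mmul[OF M' M] mmul_minv(2)[OF M] by simp
qed

lemma mob_minv_apply [simp]:
  "M \<in> SL2 A \<Longrightarrow> mob M (mob (minv M) p) = p" "M \<in> SL2 A \<Longrightarrow> mob (minv M) (mob M p) = p"
  using mob_minv by (metis comp_apply id_apply)+

lemma bij_mob: "M \<in> SL2 A \<Longrightarrow> bij (mob M)"
  using mob_minv o_bij by blast

lemma infinite_open_real:
  assumes "open S" "x \<in> (S :: real set)"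
  shows "infinite S"
  using assms by (metis finite_imp_closed clopen finite_imp_not_open empty_iff)

text \<open>The map of \<open>mmul (minv N) M\<close> fixes every point of \<open>S\<close>. Its
  real fixed points are zeros of a polynomial of degree at most 2, which has infinitely many zeros
  and hence vanishes, so that the matrix is scalar.\<close>

lemma mob_eqI_open:
  assumes M: "M \<in> SL2 A" and N: "N \<in> SL2 B" and S: "open S" "x \<in> S"
    and eq: "\<And>t. t \<in> S \<Longrightarrow> mob M (Some t) = mob N (Some t)"
  shows "mob M = mob N"
proof -
  let ?K = "mmul (minv N) M"
  obtain a b c d where K: "?K = (a,b,c,d)" by (cases ?K) auto
  have N': "minv N \<in> SL2 UNIV" using SL2_minv[OF subring_UNIV SL2_subset_UNIV[OF N]] .
  have KS: "?K \<in> SL2 UNIV" using SL2_mmul[OF subring_UNIV N' SL2_subset_UNIV[OF M]] .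
  have mK: "mob ?K = mob (minv N) \<circ> mob M" using mob_mmul[OF N' M] .
  have fixed: "mob ?K (Some t) = Some t" if "t \<in> S" for t
    using eq[OF that] N by (simp add: mK)
  have "S \<subseteq> {t. poly [:- b, d - a, c:] t = 0}"
  proof
    fix t assume "t \<in> S"
    from fixed[OF this] have "c * t + d \<noteq> 0" "(a * t + b) / (c * t + d) = t"
      by (auto simp: K mob_Some split: if_splits)
    then have "a * t + b = t * (c * t + d)" by (simp add: field_simps)
    then show "t \<in> {t. poly [:- b, d - a, c:] t = 0}" by (simp add: algebra_simps)
  qed
  then have "[:- b, d - a, c:] = 0"
    using infinite_open_real[OF S] poly_roots_finite finite_subset by blast
  then have z: "b = 0" "d = a" "c = 0" by (auto)
  then have "a \<noteq> 0" using KS by (auto simp: K SL2_iff)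
  have "mob ?K = id"
  proof
    fix p show "mob ?K p = id p" using z \<open>a \<noteq> 0\<close> by (cases p) (simp_all add: K mob_Some mob_None)
  qed
  then have "mob N \<circ> (mob (minv N) \<circ> mob M) = mob N" using mK by simp
  then show ?thesis using mob_minv(1)[OF N] by (simp flip: comp_assoc)
qed

lemma mob_eqI_openin:
  assumes M: "M \<in> SL2 A" and N: "N \<in> SL2 B" and U: "openin P1_top U" "p \<in> U"
    and eq: "\<And>q. q \<in> U \<Longrightarrow> mob M q = mob N q"
  shows "mob M = mob N"
proof -
  have o: "open {t. Some t \<in> U}" using U openin_P1 by blast
  have "\<exists>t. Some t \<in> U"
  proof (cases p)
    case None
    then obtain R where "\<forall>t. \<bar>t\<bar> > R \<longrightarrow> Some t \<in> U" using U openin_P1 by blast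
    then have "Some (\<bar>R\<bar> + 1) \<in> U" by (metis abs_ge_self abs_ge_zero abs_of_nonneg less_add_one order.strict_trans1 add_nonneg_nonneg zero_le_one)
    then show ?thesis ..
  qed (use U in blast)
  then show ?thesis using mob_eqI_open[OF M N o] eq by blast
qed

text \<open>Serves to replace a projective map by a continuous real coordinate expression, so that
  \<open>nhds\<close> filters can be transported on the real line.\<close>

lemma mob_Some_near:
  assumes "mob M (Some t) = Some s"
  obtains k where "k t = s" "isCont k t" "eventually (\<lambda>y. mob M (Some y) = Some (k y)) (nhds t)"
proof -
  obtain a b c d where M: "M = (a,b,c,d)" by (cases M) auto
  define k where "k y = (a * y + b) / (c * y + d)" for y
  have nz: "c * t + d \<noteq> 0" and "k t = s" using assms by (auto simp: M mob_Some k_def split: if_splits)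
  have "isCont k t" unfolding k_def using nz by (intro continuous_intros)
  have "open {y. c * y + d \<noteq> 0}" by (intro open_Collect_neq continuous_intros)
  then have "eventually (\<lambda>y. c * y + d \<noteq> 0) (nhds t)" using nz eventually_nhds by blast
  then have "eventually (\<lambda>y. mob M (Some y) = Some (k y)) (nhds t)"
    by eventually_elim (simp add: M mob_Some k_def)
  with that \<open>k t = s\<close> \<open>isCont k t\<close> show thesis by blast
qed

text \<open>The pieces are the real intervals between removed points; if infinity is not removed, it
  joins the two unbounded ones.\<close>

lemma P1_minus_finite_decomposition:
  assumes E: "finite (E :: P1 set)"
  obtains \<Q> where "finite \<Q>" "\<Union>\<Q> = - E" "disjoint \<Q>"
    "\<And>Q. Q \<in> \<Q> \<Longrightarrow> openin P1_top Q" "\<And>Q. Q \<in> \<Q> \<Longrightarrow> connectedin P1_top Q"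
proof -
  define F where "F = {t. Some t \<in> E}"
  have "finite (Some ` F)" by (rule finite_subset[OF _ E]) (auto simp: F_def)
  then have F: "finite F" by (rule finite_imageD) simp
  \<comment> \<open>The index is the set of removed points to the left of \<open>t\<close>. For an
    index that is not an initial segment of \<open>F\<close> the piece is empty, which does no harm
    to the required properties.\<close>
  define C where "C \<sigma> = {t. t \<notin> F \<and> {e\<in>F. e < t} = \<sigma>}" for \<sigma>
  have C_int: "is_interval (C \<sigma>)" for \<sigma>
    unfolding is_interval_1
  proof (intro ballI allI impI)
    fix a b x assume ab: "a \<in> C \<sigma>" "b \<in> C \<sigma>" "a \<le> x \<and> x \<le> b"
    then have eq: "{e\<in>F. e < a} = {e\<in>F. e < b}" by (simp add: C_def)
    have "x \<notin> F"
    proof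
      assume "x \<in> F"
      moreover have "x \<noteq> b" using ab \<open>x \<in> F\<close> by (auto simp: C_def)
      ultimately have "x \<in> {e\<in>F. e < b}" using ab by simp
      then have "x < a" unfolding eq[symmetric] by simp
      then show False using ab by simp
    qed
    moreover have "{e\<in>F. e < a} \<subseteq> {e\<in>F. e < x}" "{e\<in>F. e < x} \<subseteq> {e\<in>F. e < b}" using ab by auto
    ultimately show "x \<in> C \<sigma>" using ab by (auto simp: C_def)
  qed
  have C_open: "open (C \<sigma>)" for \<sigma>
    unfolding open_dist
  proof
    fix t assume t: "t \<in> C \<sigma>"
    have "closed F" using F by (rule finite_imp_closed)
    then obtain d where d: "d > 0" "\<And>y. dist y t < d \<Longrightarrow> y \<notin> F"
      using t unfolding closed_def open_dist C_def by auto
    have "y \<in> C \<sigma>" if y: "dist y t < d" for y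
    proof -
      have "e < y \<longleftrightarrow> e < t" if e: "e \<in> F" for e
      proof (rule ccontr)
        assume "\<not> ?thesis"
        then have "dist e t < d" using y by (auto simp: dist_real_def)
        then show False using d(2) e by blast
      qed
      then have "{e\<in>F. e < y} = {e\<in>F. e < t}" by auto
      then show ?thesis using d(2)[OF y] t by (simp add: C_def)
    qed
    then show "\<exists>d>0. \<forall>y. dist y t < d \<longrightarrow> y \<in> C \<sigma>" using d(1) by blast
  qed
  have C_disj: "C \<sigma> \<inter> C \<tau> = {}" if "\<sigma> \<noteq> \<tau>" for \<sigma> \<tau> using that by (auto simp: C_def)
  have C_mem: "t \<in> C {e\<in>F. e < t}" if "Some t \<notin> E" for t using that by (simp add: C_def F_def)
  have C_E: "Some t \<notin> E" if "t \<in> C \<sigma>" for t \<sigma> using that by (simp add: C_def F_def)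
  have arcs: "openin P1_top (Some ` C \<sigma>)" "connectedin P1_top (Some ` C \<sigma>)" for \<sigma>
    using C_open C_int by (simp_all add: openin_P1_Some connectedin_Some)
  have arc_in: "Some ` C \<sigma> \<in> (\<lambda>\<sigma>. Some ` C \<sigma>) ` P" if "\<sigma> \<in> P" for \<sigma> P
    by (rule image_eqI[where x = \<sigma>, OF refl that])
  have arcs_disj: "disjoint ((\<lambda>\<sigma>. Some ` C \<sigma>) ` P)" for P
  proof (rule disjointI)
    fix a b assume "a \<in> (\<lambda>\<sigma>. Some ` C \<sigma>) ` P" "b \<in> (\<lambda>\<sigma>. Some ` C \<sigma>) ` P" "a \<noteq> b"
    then obtain \<sigma> \<tau> where "a = Some ` C \<sigma>" "b = Some ` C \<tau>" "\<sigma> \<noteq> \<tau>" by blast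
    then show "a \<inter> b = {}" using C_disj[of \<sigma> \<tau>] by blast
  qed
  show thesis
  proof (cases "None \<in> E")
    case True
    let ?Q = "(\<lambda>\<sigma>. Some ` C \<sigma>) ` Pow F"
    show thesis
    proof (rule that[of ?Q])
      show "\<Union>?Q = - E"
      proof (intro equalityI subsetI)
        fix p assume "p \<in> - E"
        then obtain t where "p = Some t" using True by (cases p) auto
        with \<open>p \<in> - E\<close> have "p \<in> Some ` C {e\<in>F. e < t}" using C_mem[of t] by simp
        moreover have "{e\<in>F. e < t} \<in> Pow F" by blast
        ultimately show "p \<in> \<Union>?Q" using UnionI[OF arc_in] by blast
      qed (use C_E in blast)
      show "disjoint ?Q" by (rule arcs_disj)
      show "finite ?Q" using F by simp
      show "openin P1_top Q" if "Q \<in> ?Q" for Q using that arcs by blast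
      show "connectedin P1_top Q" if "Q \<in> ?Q" for Q using that arcs by blast
    qed
  next
    case False
    \<comment> \<open>The left end has index \<open>{}\<close> and the right end has index
      \<open>F\<close>. If \<open>F\<close> is empty the two coincide, and the union is still the
      right piece.\<close>
    let ?I = "insert None (Some ` C {}) \<union> insert None (Some ` C F)"
    let ?Q = "insert ?I ((\<lambda>\<sigma>. Some ` C \<sigma>) ` (Pow F - {{}, F}))"
    obtain R where R: "\<And>e. e \<in> F \<Longrightarrow> \<bar>e\<bar> \<le> R"
      using finite_imp_bounded[OF F] by (auto simp: bounded_real)
    have lo: "t \<in> C {}" if t: "t < - \<bar>R\<bar>" for t
    proof -
      have "\<not> e < t \<and> e \<noteq> t" if "e \<in> F" for e using R[OF that] t by linarith
      then show ?thesis unfolding C_def by blast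
    qed
    have hi: "t \<in> C F" if t: "t > \<bar>R\<bar>" for t
    proof -
      have "e < t \<and> e \<noteq> t" if "e \<in> F" for e using R[OF that] t by linarith
      then show ?thesis unfolding C_def by blast
    qed
    have lo': "\<exists>t\<in>C {}. \<bar>t\<bar> > r" for r
      by (rule bexI[OF _ lo[of "- \<bar>R\<bar> - \<bar>r\<bar> - 1"]]) auto
    have hi': "\<exists>t\<in>C F. \<bar>t\<bar> > r" for r
      by (rule bexI[OF _ hi[of "\<bar>R\<bar> + \<bar>r\<bar> + 1"]]) auto
    have "connectedin P1_top ?I"
      using connectedin_insert_None[OF C_int lo'] connectedin_insert_None[OF C_int hi']
      by (rule connectedin_Un) auto
    moreover have "openin P1_top ?I"
      unfolding openin_P1
    proof
      have "{t. Some t \<in> ?I} = C {} \<union> C F" by auto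
      then show "open {t. Some t \<in> ?I}" using open_Un[OF C_open C_open] by simp
      have "Some t \<in> ?I" if "\<bar>t\<bar> > \<bar>R\<bar>" for t
      proof (cases "t > 0")
        case True
        then show ?thesis using hi[of t] that by simp
      next
        case False
        then show ?thesis using lo[of t] that by simp
      qed
      then show "None \<in> ?I \<longrightarrow> (\<exists>R. \<forall>t. R < \<bar>t\<bar> \<longrightarrow> Some t \<in> ?I)" by blast
    qed
    moreover have "\<Union>?Q = - E"
    proof (intro equalityI subsetI)
      fix p assume p: "p \<in> - E"
      show "p \<in> \<Union>?Q"
      proof (cases p)
        case (Some t)
        with p have mem: "p \<in> Some ` C {e\<in>F. e < t}" using C_mem[of t] by simp
        show ?thesis
        proof (cases "{e\<in>F. e < t} = {} \<or> {e\<in>F. e < t} = F")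
          case True
          then have "p \<in> ?I" using mem by (metis UnCI insertCI)
          then show ?thesis by (rule UnionI[OF insertI1])
        next
          case False
          then have "{e\<in>F. e < t} \<in> Pow F - {{}, F}" by blast
          then show ?thesis by (rule UnionI[OF insertI2[OF arc_in] mem])
        qed
      qed simp
    next
      fix p assume p: "p \<in> \<Union>?Q"
      show "p \<in> - E"
      proof (cases p)
        case None
        then show ?thesis using False by simp
      next
        case (Some t)
        have "\<exists>\<sigma>. t \<in> C \<sigma>" using p by (auto simp: Some)
        then show ?thesis using C_E by (auto simp: Some)
      qed
    qed
    moreover have "disjoint ?Q"
    proof -
      have "disjnt ?I Q" if Q: "Q \<in> (\<lambda>\<sigma>. Some ` C \<sigma>) ` (Pow F - {{}, F})" for Q
      proof -
        obtain \<sigma> where \<sigma>: "Q = Some ` C \<sigma>" "\<sigma> \<in> Pow F - {{}, F}"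
          using Q by (rule imageE)
        then have "C {} \<inter> C \<sigma> = {}" "C F \<inter> C \<sigma> = {}" using C_disj[of "{}" \<sigma>] C_disj[of F \<sigma>] by blast+
        then show ?thesis by (auto simp: \<sigma>(1) disjnt_iff)
      qed
      then show ?thesis using arcs_disj[of "Pow F - {{}, F}"]
        unfolding pairwise_insert by (metis disjnt_sym)
    qed
    moreover have "finite ?Q" using F by simp
    moreover have "openin P1_top Q" "connectedin P1_top Q" if Q: "Q \<in> ?Q" for Q
    proof -
      from Q have "Q = ?I \<or> (\<exists>\<sigma>. Q = Some ` C \<sigma>)" by (elim insertE imageE) blast+
      then show "openin P1_top Q" "connectedin P1_top Q"
        using \<open>openin P1_top ?I\<close> \<open>connectedin P1_top ?I\<close> arcs by (elim disjE exE; metis)+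
    qed
    ultimately show thesis by (intro that[of ?Q])
  qed
qed

section \<open>Germs of piecewise projective maps\<close>

definition agree_near :: "(P1 \<Rightarrow> P1) \<Rightarrow> (P1 \<Rightarrow> P1) \<Rightarrow> P1 \<Rightarrow> bool" where
  "agree_near f g p \<longleftrightarrow> (\<exists>U. openin P1_top U \<and> p \<in> U \<and> (\<forall>q\<in>U. f q = g q))"

lemma G_set_homeo: "f \<in> G_set A \<Longrightarrow> homeomorphic_map P1_top P1_top f"
  by (simp add: G_set_def)

text \<open>This includes the breakpoints, where no projective germ need exist. It lets membership
  in \<open>P_set A\<close> be pulled back along elements of the group.\<close>

lemma G_set_pointwise: "f \<in> G_set A \<Longrightarrow> \<exists>M\<in>SL2 A. f p = mob M p"
proof -
  assume "f \<in> G_set A"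
  then obtain \<I> where \<I>: "\<Union>\<I> = UNIV" "\<And>I. I \<in> \<I> \<Longrightarrow> \<exists>M\<in>SL2 A. \<forall>x\<in>I. f x = mob M x"
    unfolding G_set_def by blast
  have "p \<in> \<Union>\<I>" using \<I>(1) by simp
  then show ?thesis using \<I>(2) by blast
qed

text \<open>The exceptional points are the frontier points of the pieces, finitely many for each.
  Any other point is interior to a piece containing it.\<close>

lemma G_set_locally:
  assumes "f \<in> G_set A"
  shows "\<exists>E. finite E \<and> E \<subseteq> P_set A \<and> (\<forall>p. p \<notin> E \<longrightarrow> (\<exists>M\<in>SL2 A. agree_near f (mob M) p))"
proof -
  obtain \<I> where \<I>: "finite \<I>" "\<Union>\<I> = UNIV"
    "\<forall>I\<in>\<I>. connectedin P1_top I \<and> P1_top frontier_of I \<subseteq> P_set A \<and> (\<exists>M\<in>SL2 A. \<forall>x\<in>I. f x = mob M x)"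
    using assms by (simp add: G_set_def) metis
  show ?thesis
  proof (intro exI[of _ "\<Union>I\<in>\<I>. P1_top frontier_of I"] conjI allI impI)
    show "finite (\<Union>I\<in>\<I>. P1_top frontier_of I)"
      using \<I> finite_frontier_connectedin_P1 by (intro finite_UN_I) simp_all
    show "(\<Union>I\<in>\<I>. P1_top frontier_of I) \<subseteq> P_set A"
      using \<I>(3) by (simp add: UN_subset_iff)
    fix p assume p: "p \<notin> (\<Union>I\<in>\<I>. P1_top frontier_of I)"
    have "p \<in> \<Union>\<I>" using \<I>(2) by simp
    then obtain I where I: "I \<in> \<I>" "p \<in> I" by (rule UnionE)
    then obtain M where M: "M \<in> SL2 A" "\<forall>x\<in>I. f x = mob M x" using \<I>(3) by blast
    have "p \<notin> P1_top frontier_of I" using p I by simp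
    moreover have "p \<in> P1_top closure_of I" using I(2) closure_of_subset[of I P1_top] by auto
    ultimately have "p \<in> P1_top interior_of I" by (simp add: frontier_of_def)
    moreover have "\<forall>q\<in>P1_top interior_of I. f q = mob M q"
      using M(2) interior_of_subset[of P1_top I] by blast
    ultimately have "agree_near f (mob M) p"
      unfolding agree_near_def using openin_interior_of[of P1_top I] by blast
    then show "\<exists>M\<in>SL2 A. agree_near f (mob M) p" using M(1) by (rule bexI)
  qed
qed

text \<open>Projective maps that agree on a nonempty open set are equal. So the points where
  \<open>f\<close> has the germ of \<open>mob M\<close> and those where it has the germ of a
  different map form disjoint open sets covering \<open>Q\<close>, and only the first meets
  \<open>Q\<close>.\<close>

lemma locally_mob_on_connected:
  assumes Q: "openin P1_top Q" "connectedin P1_top Q" "p0 \<in> Q"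
    and f: "\<And>p. p \<in> Q \<Longrightarrow> \<exists>M\<in>SL2 A. agree_near f (mob M) p"
  shows "\<exists>M\<in>SL2 A. \<forall>p\<in>Q. f p = mob M p"
proof -
  obtain M where M: "M \<in> SL2 A" "agree_near f (mob M) p0" using f[OF Q(3)] by blast
  define U where "U = \<Union>{V. openin P1_top V \<and> (\<forall>q\<in>V. f q = mob M q)}"
  define W where "W = \<Union>{V. openin P1_top V \<and> (\<exists>N\<in>SL2 A. mob N \<noteq> mob M \<and> (\<forall>q\<in>V. f q = mob N q))}"
  have o: "openin P1_top U" "openin P1_top W" unfolding U_def W_def by (rule openin_Union; simp)+
  have UQ: "f p = mob M p" if "p \<in> U" for p using that unfolding U_def by blast
  have cov: "Q \<subseteq> U \<union> W"
  proof
    fix p assume "p \<in> Q"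
    then obtain N where N: "N \<in> SL2 A" "agree_near f (mob N) p" using f by blast
    then obtain V where V: "openin P1_top V" "p \<in> V" "\<forall>q\<in>V. f q = mob N q" unfolding agree_near_def by blast
    show "p \<in> U \<union> W"
    proof (cases "mob N = mob M")
      case True
      then have "p \<in> U" unfolding U_def by (intro UnionI[OF _ V(2)]) (use V in simp)
      then show ?thesis ..
    next
      case False
      then have "p \<in> W" unfolding W_def by (intro UnionI[OF _ V(2)]) (use V N in blast)
      then show ?thesis ..
    qed
  qed
  have disj: "U \<inter> W = {}"
  proof (rule ccontr)
    assume "U \<inter> W \<noteq> {}"
    then obtain p where p: "p \<in> U" "p \<in> W" by blast
    then obtain V N where V: "openin P1_top V" "N \<in> SL2 A" "mob N \<noteq> mob M" "\<forall>q\<in>V. f q = mob N q" "p \<in> V"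
      unfolding W_def by blast
    have "mob N = mob M"
    proof (rule mob_eqI_openin[OF V(2) M(1)])
      show "openin P1_top (V \<inter> U)" using V(1) o(1) by (rule openin_Int)
      show "p \<in> V \<inter> U" using p V by simp
      show "mob N q = mob M q" if "q \<in> V \<inter> U" for q using UQ[of q] V(4) that by simp
    qed
    then show False using V(3) by simp
  qed
  obtain V where "openin P1_top V" "p0 \<in> V" "\<forall>q\<in>V. f q = mob M q" using M(2) unfolding agree_near_def by blast
  then have "p0 \<in> U" unfolding U_def by (intro UnionI[of V]) simp_all
  then have "U \<inter> Q \<noteq> {}" using Q(3) by blast
  have "W \<inter> Q = {}"
  proof (rule ccontr)
    assume "W \<inter> Q \<noteq> {}"
    then show False using Q(2) o cov disj \<open>U \<inter> Q \<noteq> {}\<close> unfolding connectedin by blast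
  qed
  then show ?thesis using cov UQ M(1) by blast
qed

text \<open>The subdivision into intervals is recovered from local data: off the finite set the
  germ of \<open>f\<close> is locally constant, hence constant on each complementary arc.\<close>

lemma G_setI:
  assumes f: "homeomorphic_map P1_top P1_top f"
    and pt: "\<And>p. \<exists>M\<in>SL2 A. f p = mob M p"
    and E: "finite E" "E \<subseteq> P_set A" "\<And>p. p \<notin> E \<Longrightarrow> \<exists>M\<in>SL2 A. agree_near f (mob M) p"
  shows "f \<in> G_set A"
proof -
  obtain \<Q> where \<Q>: "finite \<Q>" "\<Union>\<Q> = - E" "disjoint \<Q>"
    "\<And>Q. Q \<in> \<Q> \<Longrightarrow> openin P1_top Q" "\<And>Q. Q \<in> \<Q> \<Longrightarrow> connectedin P1_top Q"
    using P1_minus_finite_decomposition[OF E(1)] by blast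
  \<comment> \<open>Breakpoints enter as one-point intervals, with a matrix supplied by
    \<open>pt\<close>; the empty pieces are dropped so that a base point exists in each arc.\<close>
  let ?I = "(\<lambda>p. {p}) ` E \<union> (\<Q> - {{}})"
  have "\<forall>I\<in>?I. connectedin P1_top I \<and> P1_top frontier_of I \<subseteq> P_set A \<and> (\<exists>M\<in>SL2 A. \<forall>x\<in>I. f x = mob M x)"
  proof
    fix I assume I: "I \<in> ?I"
    show "connectedin P1_top I \<and> P1_top frontier_of I \<subseteq> P_set A \<and> (\<exists>M\<in>SL2 A. \<forall>x\<in>I. f x = mob M x)"
    proof (cases "I \<in> \<Q> - {{}}")
      case True
      then obtain p0 where p0: "p0 \<in> I" and IQ: "I \<in> \<Q>" by blast
      have "f' \<in> E" if f': "f' \<in> P1_top frontier_of I" for f'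
      proof (rule ccontr)
        assume "f' \<notin> E"
        then have "f' \<in> \<Union>\<Q>" using \<Q>(2) by simp
        then obtain J where J: "J \<in> \<Q>" "f' \<in> J" by (rule UnionE)
        have "P1_top interior_of I = I" using \<Q>(4)[OF IQ] by (rule interior_of_openin)
        then have "f' \<in> P1_top closure_of I" "f' \<notin> I" using f' by (auto simp: frontier_of_def)
        then have "I \<noteq> J" "\<exists>y. y \<in> I \<and> y \<in> J" using J \<Q>(4)[OF J(1)] unfolding in_closure_of by blast+
        then show False using \<Q>(3) IQ J(1) unfolding disjoint_def by blast
      qed
      then have "P1_top frontier_of I \<subseteq> P_set A" using E(2) by blast
      moreover have "\<exists>M\<in>SL2 A. \<forall>x\<in>I. f x = mob M x"
      proof (rule locally_mob_on_connected[OF \<Q>(4)[OF IQ] \<Q>(5)[OF IQ] p0])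
        fix p assume "p \<in> I"
        then have "p \<in> - E" using \<Q>(2) IQ by blast
        then show "\<exists>M\<in>SL2 A. agree_near f (mob M) p" using E(3) by simp
      qed
      ultimately show ?thesis using \<Q>(5)[OF IQ] by simp
    next
      case False
      then obtain p where p: "I = {p}" "p \<in> E" using I by blast
      have "openin P1_top (- {p})"
        unfolding openin_P1
      proof
        have "{t. Some t \<in> - {p}} = - {t. p = Some t}" by auto
        moreover have "closed {t. p = Some t}" by (cases p) simp_all
        ultimately show "open {t. Some t \<in> - {p}}" by (simp add: open_Compl)
        have "Some t \<in> - {p}" if "\<bar>t\<bar> > (case p of None \<Rightarrow> 0 | Some s \<Rightarrow> \<bar>s\<bar>)" for t
          using that by (cases p) auto
        then show "None \<in> - {p} \<longrightarrow> (\<exists>R. \<forall>t. R < \<bar>t\<bar> \<longrightarrow> Some t \<in> - {p})" by blast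
      qed
      then have "closedin P1_top {p}" by (simp add: closedin_def Compl_eq_Diff_UNIV)
      then have "P1_top frontier_of {p} \<subseteq> {p}" by (simp add: frontier_of_subset_eq)
      then show ?thesis using p E(2) pt[of p] by auto
    qed
  qed
  moreover have "finite ?I" using E(1) \<Q>(1) by simp
  moreover have "\<Union>?I = UNIV"
  proof -
    have "\<Union>?I = E \<union> \<Union>\<Q>" by auto
    then show ?thesis using \<Q>(2) by simp
  qed
  ultimately show ?thesis unfolding G_set_def mem_Collect_eq
    using f by (intro conjI exI[of _ ?I])
qed

text \<open>Conjugation by \<open>M\<close> turns a hyperbolic element fixing \<open>mob M p\<close>
  into one fixing \<open>p\<close>, with the same trace.\<close>

lemma P_set_mob:
  assumes A: "subring_real A" and M: "M \<in> SL2 A" and p: "mob M p \<in> P_set A"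
  shows "p \<in> P_set A"
proof -
  obtain N where N: "N \<in> SL2 A" "hyperbolic N" "mob N (mob M p) = mob M p"
    using p unfolding P_set_def by blast
  let ?K = "mmul (minv M) (mmul N M)"
  have NM: "mmul N M \<in> SL2 A" using SL2_mmul[OF A N(1) M] .
  have M': "minv M \<in> SL2 A" using SL2_minv[OF A M] .
  have "?K \<in> SL2 A" using SL2_mmul[OF A M' NM] .
  moreover have "hyperbolic ?K"
  proof -
    obtain a b c d a' b' c' d' where MN: "M = (a,b,c,d)" "N = (a',b',c',d')"
      by (cases M; cases N) auto
    have "d * (a' * a + b' * c) - b * (c' * a + d' * c) + (- c * (a' * b + b' * d) + a * (c' * b + d' * d))
      = (a * d - b * c) * (a' + d')" by (simp add: algebra_simps)
    then show ?thesis using N(2) M by (simp add: MN hyperbolic_def SL2_iff)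
  qed
  moreover have "mob ?K p = p"
    using N(3) M by (simp add: mob_mmul[OF M' NM] mob_mmul[OF N(1) M])
  ultimately show ?thesis unfolding P_set_def by blast
qed

text \<open>New breakpoints arise only at those of \<open>g\<close> and at preimages under
  \<open>g\<close> of those of \<open>f\<close>. The latter lie in \<open>P_set A\<close> because
  \<open>g\<close> acts at each point like an element of \<open>SL2 A\<close>.\<close>

lemma G_set_comp:
  assumes A: "subring_real A" and f: "f \<in> G_set A" and g: "g \<in> G_set A"
  shows "f \<circ> g \<in> G_set A"
proof -
  obtain E where E: "finite E" "E \<subseteq> P_set A" "\<And>p. p \<notin> E \<Longrightarrow> \<exists>M\<in>SL2 A. agree_near f (mob M) p"
    using G_set_locally[OF f] by blast
  obtain F where F: "finite F" "F \<subseteq> P_set A" "\<And>p. p \<notin> F \<Longrightarrow> \<exists>M\<in>SL2 A. agree_near g (mob M) p"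
    using G_set_locally[OF g] by blast
  note hf = G_set_homeo[OF f] and hg = G_set_homeo[OF g]
  have "inj g" using homeomorphic_imp_injective_map[OF hg] by simp
  show ?thesis
  proof (rule G_setI[where E = "F \<union> g -` E"])
    show "homeomorphic_map P1_top P1_top (f \<circ> g)" using hg hf by (rule homeomorphic_map_compose)
    show "finite (F \<union> g -` E)" using F(1) finite_vimageI[OF E(1) \<open>inj g\<close>] by simp
    show "F \<union> g -` E \<subseteq> P_set A"
    proof
      fix p assume "p \<in> F \<union> g -` E"
      then show "p \<in> P_set A"
      proof
        assume "p \<in> g -` E"
        then have "g p \<in> P_set A" using E(2) by blast
        moreover obtain M where "M \<in> SL2 A" "g p = mob M p" using G_set_pointwise[OF g] by blast
        ultimately show ?thesis using P_set_mob[OF A] by metis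
      qed (use F(2) in blast)
    qed
    fix p
    obtain M where M: "M \<in> SL2 A" "g p = mob M p" using G_set_pointwise[OF g] by blast
    obtain N where N: "N \<in> SL2 A" "f (g p) = mob N (g p)" using G_set_pointwise[OF f] by blast
    have "(f \<circ> g) p = mob (mmul N M) p" using M N by (simp add: mob_mmul[OF N(1) M(1)])
    then show "\<exists>M\<in>SL2 A. (f \<circ> g) p = mob M p" using SL2_mmul[OF A N(1) M(1)] by blast
    assume p: "p \<notin> F \<union> g -` E"
    then have pF: "p \<notin> F" and gpE: "g p \<notin> E" by blast+
    obtain M' U where M': "M' \<in> SL2 A" "openin P1_top U" "p \<in> U" "\<forall>q\<in>U. g q = mob M' q"
      using F(3)[OF pF] unfolding agree_near_def by blast
    obtain N' V where N': "N' \<in> SL2 A" "openin P1_top V" "g p \<in> V" "\<forall>q\<in>V. f q = mob N' q"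
      using E(3)[OF gpE] unfolding agree_near_def by blast
    have "continuous_map P1_top P1_top g" using hg by (rule homeomorphic_imp_continuous_map)
    then have "openin P1_top {x \<in> topspace P1_top. g x \<in> V}" using N'(2) by (rule openin_continuous_map_preimage)
    then have "openin P1_top {x. g x \<in> V}" by simp
    then have "openin P1_top (U \<inter> {x. g x \<in> V})" using M'(2) by (rule openin_Int[rotated])
    moreover have "\<forall>q\<in>U \<inter> {x. g x \<in> V}. (f \<circ> g) q = mob (mmul N' M') q"
      unfolding mob_mmul[OF N'(1) M'(1)] using M'(4) N'(4) by (metis IntE mem_Collect_eq comp_apply)
    ultimately have "agree_near (f \<circ> g) (mob (mmul N' M')) p"
      unfolding agree_near_def using M'(3) N'(3) by (intro exI[of _ "U \<inter> {x. g x \<in> V}"]) simp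
    then show "\<exists>M\<in>SL2 A. agree_near (f \<circ> g) (mob M) p"
      by (rule bexI[OF _ SL2_mmul[OF A N'(1) M'(1)]])
  qed
qed

lemma H_set_comp: "subring_real A \<Longrightarrow> f \<in> H_set A \<Longrightarrow> g \<in> H_set A \<Longrightarrow> f \<circ> g \<in> H_set A"
  using G_set_comp by (simp add: H_set_def)

section \<open>Extension of a projective map from the unit interval to the stabilizer of
  infinity\<close>

lemma homeomorphic_map_option:
  fixes k :: "real \<Rightarrow> real"
  assumes k: "continuous_on UNIV k" "inj k" and bd: "\<And>u. \<bar>k u - u\<bar> \<le> C"
  shows "homeomorphic_map P1_top P1_top (map_option k)"
proof (rule bijective_open_imp_homeomorphic_map)
  \<comment> \<open>Bounded displacement gives values below and above \<open>y\<close>, so the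
    intermediate value theorem applies. The same bound later handles neighbourhoods of infinity, for
    continuity and for openness.\<close>
  have surj: "\<exists>u. k u = y" for y
  proof -
    have "k (y - C) \<le> y" "y \<le> k (y + C)" using bd[of "y - C"] bd[of "y + C"] by linarith+
    moreover have "y - C \<le> y + C" using bd[of y] by linarith
    ultimately show ?thesis
      using IVT'[of k "y - C" y "y + C"] continuous_on_subset[OF k(1)] by blast
  qed
  show "continuous_map P1_top P1_top (map_option k)"
    unfolding continuous_map
  proof (intro conjI allI impI)
    fix U assume U: "openin P1_top U"
    have o: "open {t. Some t \<in> U}" and n: "None \<in> U \<Longrightarrow> \<exists>R. \<forall>t. \<bar>t\<bar> > R \<longrightarrow> Some t \<in> U"
      using U unfolding openin_P1 by blast+
    have "open (k -` {t. Some t \<in> U})" using o k(1) by (rule open_vimage)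
    moreover have "\<exists>R. \<forall>t. \<bar>t\<bar> > R \<longrightarrow> Some (k t) \<in> U" if N: "None \<in> U"
    proof -
      obtain R where R: "\<And>t. \<bar>t\<bar> > R \<Longrightarrow> Some t \<in> U" using n[OF N] by blast
      have "Some (k t) \<in> U" if "\<bar>t\<bar> > R + C" for t
        by (rule R) (use bd[of t] that in linarith)
      then show ?thesis by blast
    qed
    ultimately show "openin P1_top {x \<in> topspace P1_top. map_option k x \<in> U}"
      by (simp add: openin_P1 vimage_def)
  qed simp
  show "open_map P1_top P1_top (map_option k)"
    unfolding open_map_def
  proof (intro allI impI)
    fix U assume U: "openin P1_top U"
    have o: "open {t. Some t \<in> U}" and n: "None \<in> U \<Longrightarrow> \<exists>R. \<forall>t. \<bar>t\<bar> > R \<longrightarrow> Some t \<in> U"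
      using U unfolding openin_P1 by blast+
    have "{t. Some t \<in> map_option k ` U} = k ` {t. Some t \<in> U}"
      by (force simp: image_iff map_option_case split: option.splits)
    then have "open {t. Some t \<in> map_option k ` U}"
      using injective_into_1d_imp_open_map_UNIV[OF o k] by simp
    moreover have "\<exists>R. \<forall>t. \<bar>t\<bar> > R \<longrightarrow> Some t \<in> map_option k ` U" if N: "None \<in> map_option k ` U"
    proof -
      have "None \<in> U" using N by (auto simp: image_iff)
      then obtain R where R: "\<And>t. \<bar>t\<bar> > R \<Longrightarrow> Some t \<in> U" using n by blast
      have "Some t \<in> map_option k ` U" if t: "\<bar>t\<bar> > R + C" for t
      proof -
        obtain u where u: "k u = t" using surj by blast
        have "Some u \<in> U" by (rule R) (use bd[of u] u t in linarith)
        then show ?thesis using u by (intro image_eqI[of _ _ "Some u"]) simp_all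
      qed
      then show ?thesis by blast
    qed
    ultimately show "openin P1_top (map_option k ` U)" unfolding openin_P1 by blast
  qed
  have "p \<in> range (map_option k)" for p
  proof (cases p)
    case None
    then show ?thesis by (intro image_eqI[of _ _ None]) simp_all
  next
    case (Some t)
    obtain u where "k u = t" using surj by blast
    then show ?thesis by (intro image_eqI[of _ _ "Some u"]) (simp_all add: Some)
  qed
  then show "map_option k ` topspace P1_top = topspace P1_top" by auto
  show "inj_on (map_option k) (topspace P1_top)" using option.inj_map[OF k(2)] by simp
qed

text \<open>The values at 0 and at 1 are negative and the leading coefficient is positive, so 0 and
  1 lie strictly between the two zeros.\<close>

lemma quadratic_factorization:
  fixes \<alpha> \<beta> \<gamma> :: real
  assumes "\<alpha> > 0" "\<gamma> < 0" "\<alpha> + \<beta> + \<gamma> < 0"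
  obtains u v where "u < 0" "v > 1" "\<And>x. \<alpha> * x\<^sup>2 + \<beta> * x + \<gamma> = \<alpha> * (x - u) * (x - v)"
proof -
  define D where "D = \<beta>\<^sup>2 - 4 * \<alpha> * \<gamma>"
  have "\<alpha> * \<gamma> < 0" using assms by (simp add: mult_pos_neg)
  then have "D > 0" unfolding D_def using zero_le_power2[of \<beta>] by linarith
  then have s2: "(sqrt D)\<^sup>2 = D" and s0: "sqrt D > 0" by simp_all
  define u where "u = (- \<beta> - sqrt D) / (2 * \<alpha>)"
  define v where "v = (- \<beta> + sqrt D) / (2 * \<alpha>)"
  have sum: "u + v = - \<beta> / \<alpha>" using assms(1) by (simp add: u_def v_def field_simps)
  have uv0: "u * v = (\<beta>\<^sup>2 - (sqrt D)\<^sup>2) / (4 * \<alpha>\<^sup>2)"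
    using assms(1) by (simp add: u_def v_def field_simps power2_eq_square)
  have "\<beta>\<^sup>2 - (sqrt D)\<^sup>2 = 4 * \<alpha> * \<gamma>" unfolding s2 by (simp add: D_def)
  then have "u * v = (4 * \<alpha> * \<gamma>) / (4 * \<alpha>\<^sup>2)" by (simp only: uv0)
  then have uv: "u * v = \<gamma> / \<alpha>" using assms(1) by (simp add: power2_eq_square)
  have fac: "\<alpha> * x\<^sup>2 + \<beta> * x + \<gamma> = \<alpha> * (x - u) * (x - v)" for x
  proof -
    have "\<alpha> * (x - u) * (x - v) = \<alpha> * x\<^sup>2 - \<alpha> * (u + v) * x + \<alpha> * (u * v)"
      by (simp add: algebra_simps power2_eq_square)
    then show ?thesis using assms(1) uv sum by simp
  qed
  have "u < v" using s0 assms(1) by (simp add: u_def v_def divide_strict_right_mono)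
  have "u * v < 0" using uv assms by (simp add: divide_neg_pos)
  then have "u < 0" "v > 0" using \<open>u < v\<close> by (auto simp: mult_less_0_iff)
  have "\<alpha> * (1 - u) * (1 - v) < 0" using fac[of 1] assms(3) by simp
  moreover have "\<alpha> * (1 - u) > 0" using assms(1) \<open>u < 0\<close> by simp
  ultimately have "1 - v < 0" using mult_less_0_iff[of "\<alpha> * (1 - u)" "1 - v"] by linarith
  then have "v > 1" by simp
  with \<open>u < 0\<close> show thesis using fac by (rule that)
qed

text \<open>Outside an interval bounded by two fixed points of \<open>u \<mapsto> mob M u + r\<close>, the map
  is continued by the translation by \<open>-r\<close>, which fixes infinity.\<close>

lemma H_set_extension:
  assumes A: "subring_real A" and M: "(a,b,c,d) \<in> SL2 A" and r: "r \<in> A" and c: "c \<noteq> 0"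
    and P0: "c * (- (r * d + b)) < 0" and P1: "c * (c + (d - a - r * c) - (r * d + b)) < 0"
  shows "\<exists>g\<in>H_set A. \<forall>u. 0 \<le> u \<longrightarrow> u \<le> 1 \<longrightarrow> g (Some u) = mob (a,b,c,d) (Some u)"
proof -
  have det: "a * d - b * c = 1" using M by (simp add: SL2_iff)
  \<comment> \<open>Coefficients of the fixed point equation
    \<open>(x - r) * (c * x + d) = a * x + b\<close> multiplied by \<open>c\<close>, which makes the
    leading coefficient positive for either sign of \<open>c\<close>. The assumptions
    \<open>P0\<close> and \<open>P1\<close> concern its values at 0 and 1.\<close>
  define \<beta> where "\<beta> = c * (d - a - r * c)"
  define \<gamma> where "\<gamma> = c * (- (r * d + b))"
  have c2: "c\<^sup>2 > 0" using c by simp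
  have "c\<^sup>2 + \<beta> + \<gamma> = c * (c + (d - a - r * c) - (r * d + b))"
    by (simp add: \<beta>_def \<gamma>_def algebra_simps power2_eq_square)
  with P0 P1 obtain u1 u2 where u: "u1 < 0" "u2 > 1" and fac: "\<And>x. c\<^sup>2 * x\<^sup>2 + \<beta> * x + \<gamma> = c\<^sup>2 * (x - u1) * (x - u2)"
    using quadratic_factorization[OF c2, of \<gamma> \<beta>] by (metis \<gamma>_def)
  have fac': "c * ((x - r) * (c * x + d) - (a * x + b)) = c\<^sup>2 * (x - u1) * (x - u2)" for x
    unfolding fac[symmetric] by (simp add: \<beta>_def \<gamma>_def algebra_simps power2_eq_square)
  \<comment> \<open>At the pole \<open>- d / c\<close> the quadratic takes the value 1. Being
    positive there, it has its pole outside the interval from \<open>u1\<close> to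
    \<open>u2\<close>, so the denominator keeps one sign on it.\<close>
  have "c * ((- d / c - r) * (c * (- d / c) + d) - (a * (- d / c) + b)) = 1"
    using c det by (simp add: field_simps)
  then have pole: "c\<^sup>2 * (- d / c - u1) * (- d / c - u2) > 0" unfolding fac' by simp
  have sgn: "(c * x + d) * (c * y + d) > 0" if "u1 \<le> x" "x \<le> u2" "u1 \<le> y" "y \<le> u2" for x y
  proof -
    have "(- d / c - u1) * (- d / c - u2) > 0" using pole c2 by (simp add: mult.assoc zero_less_mult_iff)
    then have "(- d / c < x \<and> - d / c < y) \<or> (- d / c > x \<and> - d / c > y)"
      using that by (auto simp: zero_less_mult_iff)
    then have "(x - (- d / c)) * (y - (- d / c)) > 0" by (auto simp: zero_less_mult_iff)
    then have "c\<^sup>2 * ((x - (- d / c)) * (y - (- d / c))) > 0" using c2 by simp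
    also have "c\<^sup>2 * ((x - (- d / c)) * (y - (- d / c))) = (c * x + d) * (c * y + d)"
      using c by (simp add: field_simps power2_eq_square)
    finally show ?thesis .
  qed
  have nz: "c * x + d \<noteq> 0" if "u1 \<le> x" "x \<le> u2" for x using sgn[OF that that] by auto
  define g where "g x = (a * x + b) / (c * x + d)" for x
  have g_diff: "g y - g x = (y - x) / ((c * x + d) * (c * y + d))"
    if "u1 \<le> x" "x \<le> u2" "u1 \<le> y" "y \<le> u2" for x y
  proof -
    have "g y - g x = ((a * y + b) * (c * x + d) - (a * x + b) * (c * y + d)) / ((c * x + d) * (c * y + d))"
      using nz[of x] nz[of y] that by (simp add: g_def diff_frac_eq mult.commute)
    also have "(a * y + b) * (c * x + d) - (a * x + b) * (c * y + d) = (y - x) * (a * d - b * c)"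
      by (simp add: algebra_simps)
    finally show ?thesis by (simp add: det)
  qed
  have g_mono: "g x < g y" if "u1 \<le> x" "x < y" "y \<le> u2" for x y
  proof -
    have "g y - g x > 0" using g_diff[of x y] sgn[of x y] that by simp
    then show ?thesis by simp
  qed
  have g_fix: "g w = w - r" if "w = u1 \<or> w = u2" for w
  proof -
    have "(w - r) * (c * w + d) - (a * w + b) = 0" using fac'[of w] that c by auto
    moreover have "c * w + d \<noteq> 0" using nz that u by auto
    ultimately show ?thesis by (simp add: g_def field_simps)
  qed
  define k where "k x = (if u1 \<le> x \<and> x \<le> u2 then g x else x - r)" for x
  have k_in: "u1 - r \<le> k x \<and> k x \<le> u2 - r" if "u1 \<le> x" "x \<le> u2" for x
    using that g_mono[of u1 x] g_mono[of x u2] g_fix u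
    by (cases "x = u1"; cases "x = u2") (auto simp: k_def)
  have k_out: "k x = x - r" if "x \<le> u1 \<or> u2 \<le> x" for x
    using that g_fix by (auto simp: k_def)
  have "continuous_on ({u1..u2} \<union> ({..u1} \<union> {u2..})) (\<lambda>x. if u1 \<le> x \<and> x \<le> u2 then g x else x - r)"
  proof (rule continuous_on_cases)
    show "continuous_on {u1..u2} g" unfolding g_def using nz by (intro continuous_intros) auto
    show "continuous_on ({..u1} \<union> {u2..}) (\<lambda>x. x - r)" by (intro continuous_intros)
    show "\<forall>x. x \<in> {u1..u2} \<and> \<not> (u1 \<le> x \<and> x \<le> u2) \<or> x \<in> {..u1} \<union> {u2..} \<and> u1 \<le> x \<and> x \<le> u2 \<longrightarrow> g x = x - r"
      using g_fix by force
  qed auto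
  moreover have "{u1..u2} \<union> ({..u1} \<union> {u2..}) = UNIV" by auto
  ultimately have k_cont: "continuous_on UNIV k" by (simp add: k_def[abs_def])
  have k_mono: "k x < k y" if "x < y" for x y
  proof (cases "u1 \<le> x \<and> y \<le> u2")
    case True
    then show ?thesis using g_mono[of x y] that by (simp add: k_def)
  next
    case False
    then show ?thesis
      using that k_out[of x] k_out[of y] k_in[of x] k_in[of y] u by linarith
  qed
  then have k_inj: "inj k" by (metis injI linorder_neqE_linordered_idom less_irrefl)
  have k_bd: "\<bar>k x - x\<bar> \<le> \<bar>r\<bar> + (u2 - u1)" for x
    using k_in[of x] k_out[of x] u by linarith
  define f where "f = map_option k"
  have homeo: "homeomorphic_map P1_top P1_top f"
    unfolding f_def by (rule homeomorphic_map_option[OF k_cont k_inj k_bd])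
  define T :: mat2 where "T = (1, - r, 0, 1)"
  have T: "T \<in> SL2 A" using A r by (simp add: T_def SL2_iff subring_minus) (simp add: subring_real_def)
  have f_in: "f (Some x) = mob (a,b,c,d) (Some x)" if "u1 \<le> x" "x \<le> u2" for x
    using nz that by (simp add: f_def k_def g_def mob_Some)
  have f_out: "f (Some x) = mob T (Some x)" if "x \<le> u1 \<or> u2 \<le> x" for x
    using k_out[OF that] by (simp add: f_def T_def mob_Some)
  have f_None: "f None = mob T None" "f None = None" by (simp_all add: f_def T_def mob_None)
  \<comment> \<open>\<open>?K\<close> is \<open>(a,b,c,d)\<close> followed by the translation by
    \<open>r\<close>, which undoes the shift at \<open>u1\<close> and \<open>u2\<close>. The
    discriminant of the quadratic is the square of \<open>c\<close> times the squared trace of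
    \<open>?K\<close> minus 4; its positivity makes \<open>?K\<close> hyperbolic.\<close>
  have fixed: "Some w \<in> P_set A" if w: "w = u1 \<or> w = u2" for w
  proof -
    let ?K = "(a + r * c, b + r * d, c, d)"
    have "?K \<in> SL2 A" using A M r det by (simp add: SL2_iff subring_real_def algebra_simps)
    moreover have "hyperbolic ?K"
    proof -
      have "\<gamma> < 0" using P0 by (simp add: \<gamma>_def)
      then have "4 * c\<^sup>2 * \<gamma> < 0" using c2 by (simp add: mult_pos_neg)
      then have "0 < \<beta>\<^sup>2 - 4 * c\<^sup>2 * \<gamma>" using zero_le_power2[of \<beta>] by linarith
      also have "\<beta>\<^sup>2 - 4 * c\<^sup>2 * \<gamma> = c\<^sup>2 * ((a + r * c + d)\<^sup>2 - 4 * (a * d - b * c))"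
        by (simp add: \<beta>_def \<gamma>_def algebra_simps power2_eq_square)
      finally have "(a + r * c + d)\<^sup>2 > 2\<^sup>2" using c2 by (simp add: det zero_less_mult_iff)
      then have "\<bar>a + r * c + d\<bar> > \<bar>2\<bar>" using abs_le_square_iff[of "a + r * c + d" 2] by linarith
      then show ?thesis by (simp add: hyperbolic_def)
    qed
    moreover have "mob ?K (Some w) = Some w"
    proof -
      have n: "c * w + d \<noteq> 0" using nz w u by auto
      have "(a + r * c) * w + (b + r * d) = (a * w + b) + r * (c * w + d)" by (simp add: algebra_simps)
      then have "((a + r * c) * w + (b + r * d)) / (c * w + d) = g w + r"
        using nonzero_mult_div_cancel_right[OF n, of r] unfolding g_def by (simp only: add_divide_distrib)
      then show ?thesis using n g_fix[OF w] by (simp add: mob_Some)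
    qed
    ultimately show ?thesis unfolding P_set_def by blast
  qed
  have "f \<in> G_set A"
  proof (rule G_setI[OF homeo, where E = "{Some u1, Some u2}"])
    fix p
    show "\<exists>M\<in>SL2 A. f p = mob M p"
    proof (cases p)
      case None
      then show ?thesis using f_None T by blast
    next
      case (Some x)
      then show ?thesis using f_in[of x] f_out[of x] M T by (metis linear)
    qed
    assume p: "p \<notin> {Some u1, Some u2}"
    show "\<exists>M\<in>SL2 A. agree_near f (mob M) p"
    proof (cases "p \<in> Some ` {u1<..<u2}")
      case True
      moreover have "\<forall>q\<in>Some ` {u1<..<u2}. f q = mob (a,b,c,d) q" using f_in by auto
      moreover have "openin P1_top (Some ` {u1<..<u2})" by (simp add: openin_P1_Some)
      ultimately have "agree_near f (mob (a,b,c,d)) p" unfolding agree_near_def by blast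
      then show ?thesis using M by blast
    next
      case False
      let ?U = "insert None (Some ` ({..<u1} \<union> {u2<..}))"
      have "{t. Some t \<in> ?U} = {..<u1} \<union> {u2<..}" by auto
      moreover have "\<forall>t. \<bar>t\<bar> > max \<bar>u1\<bar> \<bar>u2\<bar> \<longrightarrow> Some t \<in> ?U" by auto
      ultimately have "openin P1_top ?U" unfolding openin_P1 by (metis open_Un open_greaterThan open_lessThan)
      moreover have "p \<in> ?U"
      proof (cases p)
        case (Some x)
        then have "x \<noteq> u1" "x \<noteq> u2" "x \<notin> {u1<..<u2}" using p False by blast+
        then have "x \<in> {..<u1} \<union> {u2<..}" by auto
        then show ?thesis by (simp add: Some)
      qed simp
      moreover have "\<forall>q\<in>?U. f q = mob T q" using f_out f_None(1) by (auto simp: less_imp_le)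
      ultimately have "agree_near f (mob T) p" unfolding agree_near_def by blast
      then show ?thesis using T by blast
    qed
  qed (use fixed in auto)
  then have "f \<in> H_set A" by (simp add: H_set_def infty_def f_None(2))
  moreover have "\<forall>u. 0 \<le> u \<longrightarrow> u \<le> 1 \<longrightarrow> f (Some u) = mob (a,b,c,d) (Some u)" using f_in u by simp
  ultimately show ?thesis by blast
qed

section \<open>Reduced words and the paradoxical decomposition\<close>

definition word_map :: "(letter \<Rightarrow> 'a \<Rightarrow> 'a) \<Rightarrow> letter list \<Rightarrow> 'a \<Rightarrow> 'a" where
  "word_map f w = foldr (\<lambda>s g. f s \<circ> g) w id"

lemma word_map_simps [simp]: "word_map f [] = id" "word_map f (s # w) = f s \<circ> word_map f w"
  by (simp_all add: word_map_def)

lemma word_map_append: "word_map f (u @ v) = word_map f u \<circ> word_map f v"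
  by (induction u) (simp_all add: comp_assoc)

definition inv_word :: "letter list \<Rightarrow> letter list" where
  "inv_word w = rev (map inv_letter w)"

lemma word_map_inv_word:
  assumes "\<And>s. f s \<circ> f (inv_letter s) = id"
  shows "word_map f w \<circ> word_map f (inv_word w) = id"
proof (induction w)
  case (Cons s w)
  have "word_map f (s # w) \<circ> word_map f (inv_word (s # w)) =
      f s \<circ> (word_map f w \<circ> word_map f (inv_word w)) \<circ> f (inv_letter s)"
    by (simp add: inv_word_def word_map_append comp_assoc)
  also have "\<dots> = id" by (simp only: Cons comp_id assms)
  finally show ?case .
qed (simp add: inv_word_def)

lemma reduced_inv_word: "reduced w \<Longrightarrow> reduced (inv_word w)"
  unfolding reduced_def inv_word_def successively_rev successively_map
  by (erule successively_mono) (metis inv_letter_inv_letter)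

lemma reduced_snoc: "reduced (w @ [s]) \<longleftrightarrow> reduced w \<and> (w = [] \<or> last w \<noteq> inv_letter s)"
  by (simp add: reduced_def successively_append_iff) (metis inv_letter_inv_letter)

text \<open>Free reduction: each new letter at the right end is either appended or cancels the last
  letter.\<close>

lemma word_map_reduced:
  assumes inv: "\<And>s. f s \<circ> f (inv_letter s) = id"
  shows "\<exists>w'. reduced w' \<and> word_map f w' = word_map f w"
proof (induction w rule: rev_induct)
  case Nil
  show ?case by (rule exI[of _ "[]"]) (simp add: reduced_def)
next
  case (snoc s w)
  then obtain w' where w': "reduced w'" "word_map f w' = word_map f w" by blast
  show ?case
  proof (cases "w' = [] \<or> last w' \<noteq> inv_letter s")
    case True
    then have "reduced (w' @ [s])" using w'(1) by (simp only: reduced_snoc simp_thms)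
    then show ?thesis using w'(2) by (intro exI[of _ "w' @ [s]"]) (simp add: word_map_append)
  next
    case False
    then obtain v where v: "w' = v @ [inv_letter s]" by (metis append_butlast_last_id)
    have "f (inv_letter s) \<circ> f s = id" using inv[of "inv_letter s"] by simp
    then have "word_map f (w @ [s]) = word_map f v"
      unfolding word_map_append w'(2)[symmetric] by (simp add: v word_map_append comp_assoc)
    moreover have "reduced v" using w'(1) unfolding v reduced_snoc by blast
    ultimately show ?thesis by metis
  qed
qed

text \<open>The classical paradox: in a free group, \<open>W s\<close> consists of the reduced words ending in \<open>s\<close>.
  Here it is spread over all left cosets by means of a choice of representatives.\<close>

lemma free_coset_decomposition:
  fixes f :: "letter \<Rightarrow> 'a \<Rightarrow> 'a"
  assumes inv: "\<And>s. f s \<circ> f (inv_letter s) = id"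
    and free: "\<And>w. reduced w \<Longrightarrow> w \<noteq> [] \<Longrightarrow> word_map f w \<noteq> id"
  obtains W :: "letter \<Rightarrow> ('a \<Rightarrow> 'a) set" where
    "\<And>s t \<gamma>. inj \<gamma> \<Longrightarrow> \<gamma> \<in> W s \<Longrightarrow> \<gamma> \<in> W t \<Longrightarrow> s = t"
    "\<And>s \<gamma>. \<gamma> \<notin> W (inv_letter s) \<Longrightarrow> \<gamma> \<circ> f s \<in> W s"
proof -
  define C :: "('a \<Rightarrow> 'a) \<Rightarrow> ('a \<Rightarrow> 'a) set" where "C \<gamma> = {\<gamma> \<circ> word_map f w |w. True}" for \<gamma>
  \<comment> \<open>The choice depends on the coset \<open>C \<gamma>\<close> only, so all of its
    elements share one representative.\<close>
  define \<rho> where "\<rho> \<gamma> = (SOME \<delta>. \<delta> \<in> C \<gamma>)" for \<gamma>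
  define W where "W s = {\<gamma>. \<exists>w. reduced w \<and> w \<noteq> [] \<and> last w = s \<and> \<gamma> = \<rho> \<gamma> \<circ> word_map f w}" for s
  have inv': "f (inv_letter s) \<circ> f s = id" for s using inv[of "inv_letter s"] by simp
  have "\<gamma> \<circ> word_map f [] \<in> C \<gamma>" for \<gamma> unfolding C_def by blast
  then have \<rho>C: "\<rho> \<gamma> \<in> C \<gamma>" for \<gamma> unfolding \<rho>_def by (rule someI[of "\<lambda>\<delta>. \<delta> \<in> C _"])
  have C_comp: "C (\<gamma> \<circ> f s) \<subseteq> C \<gamma>" for \<gamma> s
  proof
    fix \<delta> assume "\<delta> \<in> C (\<gamma> \<circ> f s)"
    then obtain w where "\<delta> = \<gamma> \<circ> f s \<circ> word_map f w" unfolding C_def by blast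
    then have "\<delta> = \<gamma> \<circ> word_map f (s # w)" by (simp add: comp_assoc)
    then show "\<delta> \<in> C \<gamma>" unfolding C_def by blast
  qed
  have undo: "\<gamma> \<circ> f s \<circ> f (inv_letter s) = \<gamma>" for \<gamma> s by (simp only: comp_assoc inv comp_id)
  have "C \<gamma> \<subseteq> C (\<gamma> \<circ> f s)" for \<gamma> s
    using C_comp[of "\<gamma> \<circ> f s" "inv_letter s"] unfolding undo .
  with C_comp have "C (\<gamma> \<circ> f s) = C \<gamma>" for \<gamma> s by blast
  then have \<rho>_comp: "\<rho> (\<gamma> \<circ> f s) = \<rho> \<gamma>" for \<gamma> s by (simp add: \<rho>_def)
  have ex: "\<exists>w. reduced w \<and> \<gamma> = \<rho> \<gamma> \<circ> word_map f w" for \<gamma>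
  proof -
    obtain w where w: "\<rho> \<gamma> = \<gamma> \<circ> word_map f w" using \<rho>C unfolding C_def by blast
    obtain w' where w': "reduced w'" "word_map f w' = word_map f (inv_word w)"
      using word_map_reduced[where f = f, OF inv] by blast
    have "\<rho> \<gamma> \<circ> word_map f w' = \<gamma> \<circ> (word_map f w \<circ> word_map f (inv_word w))"
      by (simp add: w w'(2) comp_assoc)
    then show ?thesis using w'(1) word_map_inv_word[where f = f, OF inv] by (metis comp_id)
  qed
  have "inj (f s)" for s using inv'[of s] by (metis inj_on_id inj_on_imageI2)
  then have inj_word: "inj (word_map f w)" for w by (induction w) (simp_all add: inj_compose)
  show thesis
  proof (rule that[of W])
    fix s t \<gamma> assume \<gamma>: "inj \<gamma>" "\<gamma> \<in> W s" "\<gamma> \<in> W t"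
    then obtain w w' where w: "reduced w" "w \<noteq> []" "last w = s" "\<gamma> = \<rho> \<gamma> \<circ> word_map f w"
      and w': "reduced w'" "w' \<noteq> []" "last w' = t" "\<gamma> = \<rho> \<gamma> \<circ> word_map f w'"
      unfolding W_def by blast
    obtain v where "\<rho> \<gamma> = \<gamma> \<circ> word_map f v" using \<rho>C unfolding C_def by blast
    \<comment> \<open>Injectivity passes from \<open>\<gamma>\<close> to its representative, which
      can then be cancelled on the left. This is why disjointness is claimed for injective maps
      only.\<close>
    then have "inj (\<rho> \<gamma>)" using \<gamma>(1) inj_word by (simp add: inj_compose)
    moreover have "\<rho> \<gamma> \<circ> word_map f w = \<rho> \<gamma> \<circ> word_map f w'" using w(4) w'(4) by simp
    ultimately have eq: "word_map f w = word_map f w'" by (simp add: fun.inj_map_strong fun_eq_iff inj_def)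
    \<comment> \<open>If the last letters differed, \<open>w\<close> followed by the inverse of
      \<open>w'\<close> would be a nonempty reduced word acting trivially.\<close>
    show "s = t"
    proof (rule ccontr)
      assume "s \<noteq> t"
      then have st: "inv_letter t \<noteq> inv_letter s" by (metis inv_letter_inv_letter)
      have hd: "hd (inv_word w') = inv_letter t" "inv_word w' \<noteq> []"
        using w'(2,3) by (simp_all add: inv_word_def hd_rev last_map)
      have "reduced (w @ inv_word w')"
        unfolding reduced_def successively_append_iff
        using w(1,3) reduced_inv_word[OF w'(1)] hd st by (simp add: reduced_def)
      moreover have "word_map f (w @ inv_word w') = id"
        unfolding word_map_append eq by (rule word_map_inv_word[where f = f, OF inv])
      ultimately show False using free w(2) by blast
    qed
  next
    fix s \<gamma> assume \<gamma>: "\<gamma> \<notin> W (inv_letter s)"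
    obtain w where w: "reduced w" "\<gamma> = \<rho> \<gamma> \<circ> word_map f w" using ex by blast
    \<comment> \<open>By assumption no reduced word leading from the representative to
      \<open>\<gamma>\<close> ends in the inverse of \<open>s\<close>, so appending \<open>s\<close>
      causes no cancellation. The empty word occurs if \<open>\<gamma>\<close> is the representative
      itself.\<close>
    have "w = [] \<or> last w \<noteq> inv_letter s" using \<gamma> w unfolding W_def by blast
    then have "reduced (w @ [s])" unfolding reduced_snoc using w(1) by blast
    moreover have "\<gamma> \<circ> f s = \<rho> (\<gamma> \<circ> f s) \<circ> word_map f (w @ [s])"
      unfolding \<rho>_comp word_map_append using w(2) by (simp flip: comp_assoc)
    ultimately show "\<gamma> \<circ> f s \<in> W s" unfolding W_def by force
  qed
qed

section \<open>Freeness of the matrix generators\<close>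

lemma gen_mat_SL2:
  assumes "subring_real A" "t \<in> A"
  shows "gen_mat t s \<in> SL2 A"
proof -
  have pow: "t ^ n \<in> A" for n using assms by (induction n) (simp_all add: subring_real_def)
  have x: "of_int (letter_sgn s) * t \<in> A" using assms subring_minus by (cases s) auto
  have cl: "y + z \<in> A" "y - z \<in> A" "y * z \<in> A" "1 \<in> A" if "y \<in> A" "z \<in> A" for y z
    using assms(1) that by (auto simp: subring_real_def)
  have one: "1 \<in> A" using assms(1) by (simp add: subring_real_def)
  show ?thesis unfolding gen_mat_def Let_def SL2_iff
    by (intro conjI cl pow x one) (simp add: algebra_simps)
qed

text \<open>Inverting \<open>u p * l x * u (- q)\<close> gives
  \<open>u q * l (- x) * u (- p)\<close>: the two exponents change places and the sign
  flips.\<close>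

lemma gen_mat_inv: "gen_mat t (inv_letter s) = minv (gen_mat t s)"
  by (simp add: gen_mat_def Let_def algebra_simps)

lemma word_map_gen_mat:
  "word_mat t w \<in> SL2 UNIV \<and> word_map (\<lambda>s. mob (gen_mat t s)) w = mob (word_mat t w)"
proof (induction w rule: rev_induct)
  case Nil
  show ?case using SL2_one[OF subring_UNIV] mob_one by (simp add: word_mat_def)
next
  case (snoc s w)
  have g: "gen_mat t s \<in> SL2 UNIV" using gen_mat_SL2[OF subring_UNIV] by simp
  have w: "word_mat t (w @ [s]) = mmul (word_mat t w) (gen_mat t s)" by (simp add: word_mat_def)
  have IH: "word_mat t w \<in> SL2 UNIV" "word_map (\<lambda>s. mob (gen_mat t s)) w = mob (word_mat t w)"
    using snoc by blast+
  show ?case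
    unfolding w word_map_append IH(2) mob_mmul[OF IH(1) g]
    using SL2_mmul[OF subring_UNIV IH(1) g] by simp
qed

text \<open>A nonempty reduced word moves infinity, because its lower left entry is nonzero.\<close>

lemma gen_mat_free:
  assumes "\<And>q. unit_dominant q \<Longrightarrow> ieval q t \<noteq> 0" "reduced w" "w \<noteq> []"
  shows "word_map (\<lambda>s. mob (gen_mat t s)) w \<noteq> id"
proof
  assume "word_map (\<lambda>s. mob (gen_mat t s)) w = id"
  then have id: "mob (word_mat t w) None = None" using word_map_gen_mat[of t w] by simp
  obtain a b c d where M: "word_mat t w = (a,b,c,d)" by (cases "word_mat t w") auto
  have "c \<noteq> 0" using word_mat_lower_left[OF assms(2,3) assms(1) M] .
  then show False using id by (simp add: M mob_None)
qed

section \<open>Germs and their measure\<close>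

definition mobs :: "(P1 \<Rightarrow> P1) set" where
  "mobs = mob ` SL2 UNIV"

text \<open>The points near which the inverse of \<open>h\<close> coincides with a projective map belonging to \<open>V\<close>.\<close>

definition germ_set :: "(P1 \<Rightarrow> P1) \<Rightarrow> (P1 \<Rightarrow> P1) set \<Rightarrow> real set" where
  "germ_set h V = {x. \<exists>\<phi>\<in>V \<inter> mobs. eventually (\<lambda>y. h (\<phi> (Some y)) = Some y) (nhds x)}"

lemma open_germ_set: "open (germ_set h V)"
proof (subst open_subopen, intro ballI)
  fix x assume "x \<in> germ_set h V"
  then obtain \<phi> where \<phi>: "\<phi> \<in> V \<inter> mobs" "eventually (\<lambda>y. h (\<phi> (Some y)) = Some y) (nhds x)"
    unfolding germ_set_def by blast
  then obtain S where S: "open S" "x \<in> S" "\<forall>y\<in>S. h (\<phi> (Some y)) = Some y"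
    unfolding eventually_nhds by blast
  have "S \<subseteq> germ_set h V"
  proof
    fix y assume "y \<in> S"
    then have "eventually (\<lambda>y. h (\<phi> (Some y)) = Some y) (nhds y)"
      unfolding eventually_nhds using S by blast
    then show "y \<in> germ_set h V" unfolding germ_set_def using \<phi>(1) by blast
  qed
  then show "\<exists>T. open T \<and> x \<in> T \<and> T \<subseteq> germ_set h V" using S by blast
qed

text \<open>Since \<open>h\<close> is injective, its inverse has at most one projective germ at
  \<open>x\<close>, and a germ determines the projective map. Hence disjoint sets of projective maps
  have disjoint germ sets.\<close>

lemma germ_set_unique:
  assumes h: "inj h" and x: "x \<in> germ_set h V" "x \<in> germ_set h V'"
  obtains M where "M \<in> SL2 UNIV" "mob M \<in> V" "mob M \<in> V'"
proof -
  obtain M where M: "M \<in> SL2 UNIV" "mob M \<in> V" "eventually (\<lambda>y. h (mob M (Some y)) = Some y) (nhds x)"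
    using x(1) unfolding germ_set_def mobs_def by blast
  obtain N where N: "N \<in> SL2 UNIV" "mob N \<in> V'" "eventually (\<lambda>y. h (mob N (Some y)) = Some y) (nhds x)"
    using x(2) unfolding germ_set_def mobs_def by blast
  have "eventually (\<lambda>y. mob M (Some y) = mob N (Some y)) (nhds x)"
    using M(3) N(3)
  proof eventually_elim
    case (elim y)
    then have "h (mob M (Some y)) = h (mob N (Some y))" by simp
    then show ?case using h by (simp add: inj_eq)
  qed
  then obtain S where S: "open S" "x \<in> S" "\<forall>y\<in>S. mob M (Some y) = mob N (Some y)"
    unfolding eventually_nhds by blast
  then have "mob M = mob N" by (intro mob_eqI_open[OF M(1) N(1) S(1,2)]) blast
  then show thesis using that M N by simp
qed

text \<open>Only the images of infinity and of the breakpoints of \<open>h\<close> can be missed: at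
  the image of any other point, the inverse of \<open>h\<close> is locally
  \<open>mob (minv M)\<close>.\<close>

lemma germ_set_cofinite:
  assumes "h \<in> G_set A"
  shows "finite (- germ_set h UNIV)"
proof -
  obtain E where E: "finite E" "E \<subseteq> P_set A" "\<forall>p. p \<notin> E \<longrightarrow> (\<exists>M\<in>SL2 A. agree_near h (mob M) p)"
    using G_set_locally[OF assms] by blast
  have surj: "h ` UNIV = UNIV"
    using homeomorphic_imp_surjective_map[OF G_set_homeo[OF assms]] by simp
  have "x \<in> germ_set h UNIV" if x: "Some x \<notin> h ` insert None E" for x
  proof -
    have "Some x \<in> h ` UNIV" unfolding surj by simp
    then obtain p where p: "h p = Some x" by (metis imageE)
    have "p \<notin> insert None E"
    proof
      assume "p \<in> insert None E"
      then have "h p \<in> h ` insert None E" by (rule imageI)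
      then show False using x p by simp
    qed
    then have "p \<notin> E" and "\<not> p = None" by simp_all
    then obtain t where t: "p = Some t" by blast
    obtain M U where M: "M \<in> SL2 A" "openin P1_top U" "p \<in> U" "\<forall>q\<in>U. h q = mob M q"
      using E(3) \<open>p \<notin> E\<close> unfolding agree_near_def by blast
    have "mob M p = Some x" using M p by simp
    then have "mob (minv M) (Some x) = Some t" using mob_minv_apply(2)[OF M(1), of p] t by simp
    then obtain k where k: "k x = t" "isCont k x" "eventually (\<lambda>y. mob (minv M) (Some y) = Some (k y)) (nhds x)"
      by (rule mob_Some_near)
    have "open {u. Some u \<in> U}" using M(2) openin_P1 by blast
    moreover have "k x \<in> {u. Some u \<in> U}" using M(3) k(1) t by simp
    moreover have "filterlim k (nhds (k x)) (nhds x)"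
      using k(2) tendsto_at_iff_tendsto_nhds[of k x] unfolding continuous_at by blast
    ultimately have "eventually (\<lambda>y. k y \<in> {u. Some u \<in> U}) (nhds x)"
      by (intro topological_tendstoD)
    with k(3) have "eventually (\<lambda>y. h (mob (minv M) (Some y)) = Some y) (nhds x)"
    proof eventually_elim
      case (elim y)
      then have "h (mob (minv M) (Some y)) = mob M (mob (minv M) (Some y))" using M(4) by simp
      then show ?case using mob_minv_apply(1)[OF M(1)] by simp
    qed
    moreover have "mob (minv M) \<in> mobs"
      unfolding mobs_def using SL2_minv[OF subring_UNIV SL2_subset_UNIV[OF M(1)]] by blast
    ultimately show ?thesis unfolding germ_set_def by blast
  qed
  then have "Some ` (- germ_set h UNIV) \<subseteq> h ` insert None E" by blast
  then have "finite (Some ` (- germ_set h UNIV))" using E(1) by (meson finite.insertI finite_imageI finite_subset)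
  then show ?thesis by (rule finite_imageD) simp
qed

text \<open>Near \<open>x'\<close> the inverse of \<open>g \<circ> h\<close> is
  \<open>mob (minv N)\<close> followed by the inverse of \<open>h\<close>, so its germ is that of
  \<open>h\<close> at \<open>x\<close> composed on the right with
  \<open>mob (minv N)\<close>.\<close>

lemma germ_set_translate:
  assumes N: "N \<in> SL2 UNIV" and J: "open J" "\<And>y. y \<in> J \<Longrightarrow> g (Some y) = mob N (Some y)"
    and x: "x \<in> J" "x \<in> germ_set h V" "mob N (Some x) = Some x'"
    and V': "\<And>\<phi>. \<phi> \<in> V \<Longrightarrow> \<phi> \<circ> mob (minv N) \<in> V'"
  shows "x' \<in> germ_set (g \<circ> h) V'"
proof -
  have N': "minv N \<in> SL2 UNIV" using SL2_minv[OF subring_UNIV N] .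
  obtain M where M: "M \<in> SL2 UNIV" "mob M \<in> V" and ev: "eventually (\<lambda>y. h (mob M (Some y)) = Some y) (nhds x)"
    using x(2) unfolding germ_set_def mobs_def by blast
  have "mob (minv N) (Some x') = Some x" using mob_minv_apply(2)[OF N, of "Some x"] x(3) by simp
  then obtain k where k: "k x' = x" "isCont k x'" "eventually (\<lambda>y. mob (minv N) (Some y) = Some (k y)) (nhds x')"
    by (rule mob_Some_near)
  have lim: "filterlim k (nhds x) (nhds x')"
    using k(2) tendsto_at_iff_tendsto_nhds[of k x'] unfolding continuous_at k(1) by blast
  have "eventually (\<lambda>y. y \<in> J) (nhds x)" using J(1) x(1) by (rule eventually_nhds_in_open)
  with ev have "eventually (\<lambda>y. h (mob M (Some y)) = Some y \<and> y \<in> J) (nhds x)" by (rule eventually_conj)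
  then have "eventually (\<lambda>y. h (mob M (Some (k y))) = Some (k y) \<and> k y \<in> J) (nhds x')"
    using lim by (rule eventually_compose_filterlim)
  with k(3) have "eventually (\<lambda>y. (g \<circ> h) ((mob M \<circ> mob (minv N)) (Some y)) = Some y) (nhds x')"
  proof eventually_elim
    case (elim y)
    then have "(g \<circ> h) ((mob M \<circ> mob (minv N)) (Some y)) = mob N (mob (minv N) (Some y))"
      using J(2)[of "k y"] by simp
    then show ?case using mob_minv_apply(1)[OF N] by simp
  qed
  moreover have "mob M \<circ> mob (minv N) \<in> mobs"
    unfolding mobs_def mob_mmul[OF M(1) N', symmetric] using SL2_mmul[OF subring_UNIV M(1) N'] by blast
  ultimately show ?thesis unfolding germ_set_def using V'[OF M(2)] by blast
qed

section \<open>Estimates for matrices close to the identity\<close>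

fun near_one :: "mat2 \<Rightarrow> bool" where
  "near_one (a,b,c,d) \<longleftrightarrow> \<bar>a - 1\<bar> \<le> 1/1000 \<and> \<bar>b\<bar> \<le> 1/1000 \<and> \<bar>c\<bar> \<le> 1/1000 \<and> \<bar>d - 1\<bar> \<le> 1/1000 \<and> c \<noteq> 0"

lemma near_one_gen_mat:
  assumes "0 < t" "t \<le> 1/2000"
  shows "near_one (gen_mat t s)"
proof -
  define p where "p = t ^ letter_exp s"
  define q where "q = t ^ letter_exp (inv_letter s)"
  define x where "x = of_int (letter_sgn s) * t"
  have pow: "0 \<le> t ^ n \<and> t ^ n \<le> t" if "n > 0" for n
    using power_decreasing[of 1 n t] assms that by simp
  have p: "0 \<le> p" "p \<le> t" and q: "0 \<le> q" "q \<le> t"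
    using pow letter_exp_pos by (simp_all add: p_def q_def)
  have x: "\<bar>x\<bar> = t" using assms by (simp add: x_def abs_mult flip: of_int_abs)
  have px: "\<bar>p * x\<bar> \<le> t * 1" "\<bar>x * q\<bar> \<le> t * 1"
    using p q x assms mult_mono[of p t t 1] mult_mono[of q t t 1] by (auto simp: abs_mult mult.commute)
  have "\<bar>q * (p * x)\<bar> \<le> t * (1/4)"
    unfolding abs_mult using q px x assms by (intro mult_mono) auto
  moreover have "p - q * (1 + p * x) = (p - q) - q * (p * x)" by (simp add: algebra_simps)
  moreover have "\<bar>p - q\<bar> \<le> t" using p q by linarith
  ultimately have "\<bar>p - q * (1 + p * x)\<bar> \<le> 1/1000" using assms(2) by linarith
  then show ?thesis using px x assms unfolding gen_mat_def Let_def p_def[symmetric] q_def[symmetric] x_def[symmetric]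
    by auto
qed

lemma near_one_denominator:
  assumes "near_one (a,b,c,d)" "0 < x" "x < 1"
  shows "c * x + d \<ge> 499/500"
proof -
  have "\<bar>c * x\<bar> \<le> 1/1000 * 1" unfolding abs_mult using assms by (intro mult_mono) auto
  moreover have "\<bar>d - 1\<bar> \<le> 1/1000" using assms(1) by simp
  ultimately show ?thesis by linarith
qed

lemma near_one_displacement:
  assumes M: "near_one (a,b,c,d)" and x: "0 < x" "x < 1"
  shows "\<bar>(a * x + b) / (c * x + d) - x\<bar> \<le> 1/100"
proof -
  note den = near_one_denominator[OF M x]
  have "\<bar>(a - 1) * x\<bar> \<le> 1/1000 * 1" "\<bar>(d - 1) * x\<bar> \<le> 1/1000 * 1" "\<bar>c * (x * x)\<bar> \<le> 1/1000 * (1 * 1)"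
    unfolding abs_mult using M x by (intro mult_mono; auto)+
  moreover have "a * x + b - x * (c * x + d) = (a - 1) * x + b - c * (x * x) - (d - 1) * x"
    by (simp add: algebra_simps)
  moreover have "\<bar>b\<bar> \<le> 1/1000" using M by simp
  ultimately have num: "\<bar>a * x + b - x * (c * x + d)\<bar> \<le> 4/1000" by linarith
  have "(a * x + b) / (c * x + d) - x = (a * x + b - x * (c * x + d)) / (c * x + d)"
    using den by (simp add: diff_divide_distrib)
  also have "\<bar>\<dots>\<bar> \<le> (4/1000) / (499/500)"
    unfolding abs_divide using num den by (intro frac_le) auto
  finally show ?thesis by simp
qed

text \<open>Change of variables: the derivative is the inverse square of \<open>c * x + d\<close>, a
  denominator of at least 499/500, and so is at most 101/100.\<close>

lemma near_one_measure_image: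
  assumes M: "near_one (a,b,c,d)" and det: "a * d - b * c = 1" and T: "open T" "T \<subseteq> {0<..<1}"
  defines "k \<equiv> \<lambda>x. (a * x + b) / (c * x + d)"
  shows "k ` T \<in> lmeasurable" "measure lebesgue (k ` T) \<le> 101/100 * measure lebesgue T"
proof -
  have den: "c * x + d \<ge> 499/500" if "x \<in> T" for x
    using near_one_denominator[OF M, of x] T(2) that by auto
  have cont: "continuous_on T k" unfolding k_def
    by (intro continuous_intros) (use den in force)
  have inj: "inj_on k T"
  proof (rule inj_onI)
    fix x y assume xy: "x \<in> T" "y \<in> T" "k x = k y"
    have "(a * x + b) * (c * y + d) = (a * y + b) * (c * x + d)"
      using xy(3) den[OF xy(1)] den[OF xy(2)] by (simp add: k_def frac_eq_eq)
    then have "(x - y) * (a * d - b * c) = 0" by (simp add: algebra_simps)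
    then show "x = y" using det by simp
  qed
  have "open (k ` T)" using injective_into_1d_imp_open_map_UNIV[OF T(1) cont inj] by simp
  moreover have "k ` T \<subseteq> {-1..2}"
  proof
    fix y assume "y \<in> k ` T"
    then obtain x where x: "x \<in> T" and y: "y = k x" by blast
    have x01: "0 < x" "x < 1" using T(2) x by auto
    have "\<bar>k x - x\<bar> \<le> 1/100" unfolding k_def by (rule near_one_displacement[OF M x01])
    then have "-1 \<le> k x" "k x \<le> 2" using x01 by linarith+
    then show "y \<in> {-1..2}" by (simp add: y)
  qed
  ultimately show kT: "k ` T \<in> lmeasurable"
    by (intro lmeasurable_open bounded_subset[OF bounded_closed_interval])
  have "T \<subseteq> {0..1}" using T(2) by force
  then have Tm: "T \<in> lmeasurable"
    using T(1) by (intro lmeasurable_open bounded_subset[OF bounded_closed_interval])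
  have der: "(k has_field_derivative 1 / (c * x + d)\<^sup>2) (at x within T)" if "x \<in> T" for x
  proof -
    have nz: "c * x + d \<noteq> 0" using den[OF that] by auto
    have "a * (c * x + d) - (a * x + b) * c = 1" using det by (simp add: algebra_simps)
    then show ?thesis unfolding k_def
      by (auto intro!: derivative_eq_intros simp: nz power2_eq_square)
  qed
  have one: "(\<lambda>_. 1 :: real) absolutely_integrable_on (k ` T)" using kT by (simp add: lmeasurable_iff_has_integral absolutely_integrable_on_const)
  have "(\<lambda>x. \<bar>1 / (c * x + d)\<^sup>2\<bar> * 1) absolutely_integrable_on T \<and>
      integral T (\<lambda>x. \<bar>1 / (c * x + d)\<^sup>2\<bar> * 1) = integral (k ` T) (\<lambda>_. 1 :: real)
    \<longleftrightarrow> (\<lambda>_. 1 :: real) absolutely_integrable_on (k ` T) \<and> integral (k ` T) (\<lambda>_. 1 :: real) = integral (k ` T) (\<lambda>_. 1)"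
    by (rule has_absolute_integral_change_of_variables_1'[OF fmeasurableD[OF Tm] der inj])
  with one have "(\<lambda>x. \<bar>1 / (c * x + d)\<^sup>2\<bar> * 1) absolutely_integrable_on T \<and>
      integral T (\<lambda>x. \<bar>1 / (c * x + d)\<^sup>2\<bar> * 1) = integral (k ` T) (\<lambda>_. 1 :: real)"
    by blast
  then have int: "(\<lambda>x. \<bar>1 / (c * x + d)\<^sup>2\<bar> * 1) integrable_on T"
    and eq: "integral T (\<lambda>x. \<bar>1 / (c * x + d)\<^sup>2\<bar> * 1) = measure lebesgue (k ` T)"
    using kT by (auto simp: set_lebesgue_integral_eq_integral lmeasure_integral)
  have "integral T (\<lambda>x. \<bar>1 / (c * x + d)\<^sup>2\<bar> * 1) \<le> integral T (\<lambda>x. 101/100)"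
  proof (rule integral_le[OF int])
    show "(\<lambda>x. 101/100 :: real) integrable_on T"
      using Tm by (simp add: integrable_on_const)
    fix x assume "x \<in> T"
    have "(499/500)\<^sup>2 \<le> (c * x + d)\<^sup>2" using den[OF \<open>x \<in> T\<close>] by (intro power_mono) auto
    then have "1 / (c * x + d)\<^sup>2 \<le> 1 / (499/500)\<^sup>2" by (intro frac_le) auto
    also have "\<dots> \<le> (101/100 :: real)" by (simp add: power2_eq_square)
    finally show "\<bar>1 / (c * x + d)\<^sup>2\<bar> * 1 \<le> 101/100" by simp
  qed
  also have "integral T (\<lambda>x. 101/100 :: real) = 101/100 * measure lebesgue T"
    using Tm by (simp add: lmeasure_integral flip: integral_mult_right)
  finally show "measure lebesgue (k ` T) \<le> 101/100 * measure lebesgue T" by (simp only: eq)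
qed

text \<open>Take \<open>r = 1\<close> or \<open>r = - 1\<close> according to the sign of
  \<open>c\<close>. As the matrix is close to the identity, the quantities that \<open>c\<close>
  multiplies in the two sign conditions are both close to \<open>- r\<close>. The clause
  \<open>c \<noteq> 0\<close> of \<open>near_one\<close> is there for this choice.\<close>

lemma near_one_H_set_extension:
  assumes A: "subring_real A" and M: "M \<in> SL2 A" "near_one M"
  shows "\<exists>g\<in>H_set A. \<forall>u. 0 \<le> u \<longrightarrow> u \<le> 1 \<longrightarrow> g (Some u) = mob M (Some u)"
proof -
  obtain a b c d where abcd: "M = (a,b,c,d)" by (cases M) auto
  have near: "\<bar>a - 1\<bar> \<le> 1/1000" "\<bar>b\<bar> \<le> 1/1000" "\<bar>c\<bar> \<le> 1/1000" "\<bar>d - 1\<bar> \<le> 1/1000" "c \<noteq> 0"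
    using M(2) by (simp_all add: abcd)
  have "1 \<in> A" "- 1 \<in> A" using A subring_minus[OF A, of 1] by (simp_all add: subring_real_def)
  show ?thesis
  proof (cases "c > 0")
    case True
    then have "c * (- (1 * d + b)) < 0" "c * (c + (d - a - 1 * c) - (1 * d + b)) < 0"
      using near by (intro mult_pos_neg; linarith)+
    then show ?thesis using H_set_extension[OF A M(1)[unfolded abcd] \<open>1 \<in> A\<close> near(5)] abcd by blast
  next
    case False
    then have "c < 0" using near(5) by simp
    then have "c * (- (- 1 * d + b)) < 0" "c * (c + (d - a - - 1 * c) - (- 1 * d + b)) < 0"
      using near by (intro mult_neg_pos; linarith)+
    then show ?thesis using H_set_extension[OF A M(1)[unfolded abcd] \<open>- 1 \<in> A\<close> near(5)] abcd by blast
  qed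
qed

section \<open>The mass of germ sets in the unit interval\<close>

definition germ_mass :: "(P1 \<Rightarrow> P1) \<Rightarrow> (P1 \<Rightarrow> P1) set \<Rightarrow> real" where
  "germ_mass h V = measure lebesgue ({0<..<1} \<inter> germ_set h V)"

lemma lmeasurable_Ioo_Int: "open S \<Longrightarrow> {a<..<b::real} \<inter> S \<in> lmeasurable"
  by (rule lmeasurable_open) (auto intro: bounded_subset[OF bounded_closed_interval[of a b]])

lemma germ_mass_nonneg: "germ_mass h V \<ge> 0"
  by (simp add: germ_mass_def)

text \<open>All but finitely many points carry a projective germ, which lies in \<open>V\<close> or
  in its complement, and finite sets have measure 0.\<close>

lemma germ_mass_Compl:
  assumes "h \<in> G_set A"
  shows "germ_mass h V + germ_mass h (- V) \<ge> 1"
proof -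
  let ?D = "\<lambda>V. {0<..<1} \<inter> germ_set h V"
  let ?F = "- germ_set h UNIV"
  have fin: "finite ?F" by (rule germ_set_cofinite[OF assms])
  then have F: "?F \<in> lmeasurable" "measure lebesgue ?F = 0"
    using negligible_finite negligible_iff_measure by blast+
  have D: "?D V \<in> lmeasurable" for V by (rule lmeasurable_Ioo_Int[OF open_germ_set])
  have "{0<..<1} \<subseteq> (?D V \<union> ?D (- V)) \<union> ?F" by (auto simp: germ_set_def)
  then have "measure lebesgue {0<..<1::real} \<le> measure lebesgue ((?D V \<union> ?D (- V)) \<union> ?F)"
    by (intro measure_mono_fmeasurable) (use D F in \<open>auto intro: fmeasurable.Un\<close>)
  also have "\<dots> \<le> measure lebesgue (?D V \<union> ?D (- V)) + measure lebesgue ?F"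
    using D F by (intro measure_Un_le) auto
  also have "\<dots> \<le> measure lebesgue (?D V) + measure lebesgue (?D (- V))"
    using D F(2) measure_Un_le[of "?D V" lebesgue "?D (- V)"] by auto
  finally show ?thesis by (simp add: germ_mass_def)
qed

lemma germ_mass_sum_le:
  fixes W :: "'s \<Rightarrow> (P1 \<Rightarrow> P1) set"
  assumes h: "inj h" and S: "finite S"
    and W: "\<And>s t \<gamma>. inj \<gamma> \<Longrightarrow> \<gamma> \<in> W s \<Longrightarrow> \<gamma> \<in> W t \<Longrightarrow> s = t"
  shows "(\<Sum>s\<in>S. germ_mass h (W s)) \<le> 1"
proof -
  let ?D = "\<lambda>s. {0<..<1} \<inter> germ_set h (W s)"
  have D: "?D s \<in> lmeasurable" for s by (rule lmeasurable_Ioo_Int[OF open_germ_set])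
  have fin: "emeasure lebesgue (?D s) \<noteq> \<infinity>" for s
    using fmeasurableD2[OF D[of s]] unfolding infinity_ennreal_def .
  have "disjoint_family_on ?D S"
    unfolding disjoint_family_on_def
  proof (intro ballI impI)
    fix s t :: 's assume "s \<noteq> t"
    show "?D s \<inter> ?D t = {}"
    proof (rule ccontr)
      assume "?D s \<inter> ?D t \<noteq> {}"
      then obtain x where "x \<in> germ_set h (W s)" "x \<in> germ_set h (W t)" by blast
      then obtain M where "M \<in> SL2 UNIV" "mob M \<in> W s" "mob M \<in> W t"
        by (rule germ_set_unique[OF h])
      then show False using W[OF bij_is_inj[OF bij_mob]] \<open>s \<noteq> t\<close> by blast
    qed
  qed
  then have "(\<Sum>s\<in>S. germ_mass h (W s)) = measure lebesgue (\<Union>s\<in>S. ?D s)"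
    unfolding germ_mass_def
    by (intro measure_finite_Union[symmetric] S image_subsetI fmeasurableD[OF D] fin)
  also have "\<dots> \<le> measure lebesgue {0<..<1::real}"
    by (intro measure_mono_fmeasurable UN_least Int_lower1 sets.finite_UN[OF S fmeasurableD[OF D]]) simp
  finally show ?thesis by simp
qed

text \<open>Where the germ of \<open>h\<close> lies outside \<open>V\<close>, the translate has a
  germ in \<open>V'\<close> at the image point. Displacements are at most 1/100, so discarding that
  margin at both ends, of total length 1/50, keeps the image points in the unit interval. Mapping
  back by \<open>K\<close> costs the factor 101/100.\<close>

lemma germ_mass_translate:
  assumes A: "subring_real A" and K: "K \<in> SL2 A" "near_one K" "near_one (minv K)"
    and h: "h \<in> H_set A" and g: "\<And>u. 0 \<le> u \<Longrightarrow> u \<le> 1 \<Longrightarrow> g (Some u) = mob (minv K) (Some u)"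
    and V: "\<And>\<phi>. \<phi> \<notin> V \<Longrightarrow> \<phi> \<circ> mob K \<in> V'"
  shows "1 - germ_mass h V - 1/50 \<le> 101/100 * germ_mass (g \<circ> h) V'"
proof -
  obtain a b c d where abcd: "K = (a,b,c,d)" by (cases K) auto
  have det: "a * d - b * c = 1" using K(1) by (simp add: abcd SL2_iff)
  define k where "k x = (a * x + b) / (c * x + d)" for x
  let ?T = "{0<..<1} \<inter> germ_set (g \<circ> h) V'"
  let ?S = "{1/100<..<99/100} \<inter> germ_set h (- V)"
  have K': "minv K \<in> SL2 UNIV" using SL2_minv[OF subring_UNIV SL2_subset_UNIV[OF K(1)]] .
  have minv2: "minv (minv K) = K" by (simp add: abcd)
  have sub: "?S \<subseteq> k ` ?T"
  proof
    fix x assume x: "x \<in> ?S"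
    then have x01: "0 < x" "x < 1" by auto
    have N: "near_one (d, - b, - c, a)" using K(3) by (simp add: abcd)
    define x' where "x' = (d * x + - b) / (- c * x + a)"
    have den: "- c * x + a \<noteq> 0" using near_one_denominator[OF N x01] by linarith
    then have mx: "mob (minv K) (Some x) = Some x'" by (simp add: abcd mob_Some x'_def)
    have "\<bar>x' - x\<bar> \<le> 1/100" unfolding x'_def by (rule near_one_displacement[OF N x01])
    moreover have "1/100 < x" "x < 99/100" using x by auto
    ultimately have x'01: "0 < x'" "x' < 1" by linarith+
    have "x' \<in> germ_set (g \<circ> h) V'"
    proof (rule germ_set_translate[OF K' open_greaterThanLessThan[of 0 1]])
      show "x \<in> {0<..<1}" using x01 by simp
      show "x \<in> germ_set h (- V)" using x by simp
      show "mob (minv K) (Some x) = Some x'" by (rule mx)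
      show "g (Some y) = mob (minv K) (Some y)" if "y \<in> {0<..<1}" for y using g that by simp
      show "\<phi> \<circ> mob (minv (minv K)) \<in> V'" if "\<phi> \<in> - V" for \<phi> using V that by (simp add: minv2)
    qed
    moreover have "mob K (Some x') = Some x" using mob_minv_apply(1)[OF K(1), of "Some x"] mx by simp
    then have "x = k x'" by (simp add: abcd mob_Some k_def split: if_splits)
    ultimately show "x \<in> k ` ?T" using x'01 by (intro image_eqI[of _ _ x']) auto
  qed
  have T: "open ?T" "?T \<subseteq> {0<..<1}" using open_germ_set by auto
  note img = near_one_measure_image[OF K(2)[unfolded abcd] det T, folded k_def]
  have S: "?S \<in> lmeasurable" by (rule lmeasurable_Ioo_Int[OF open_germ_set])
  have "measure lebesgue ?S \<le> measure lebesgue (k ` ?T)"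
    using sub S img(1) by (intro measure_mono_fmeasurable) auto
  also have "\<dots> \<le> 101/100 * germ_mass (g \<circ> h) V'" using img(2) by (simp add: germ_mass_def)
  finally have up: "measure lebesgue ?S \<le> 101/100 * germ_mass (g \<circ> h) V'" .
  have "{0<..<1} \<inter> germ_set h (- V) \<subseteq> ?S \<union> ({0..1/100} \<union> {99/100..1})" by auto
  then have "germ_mass h (- V) \<le> measure lebesgue (?S \<union> ({0..1/100} \<union> {99/100..1::real}))"
    unfolding germ_mass_def using lmeasurable_Ioo_Int[OF open_germ_set] S
    by (intro measure_mono_fmeasurable) (auto intro!: fmeasurable.Un)
  also have "\<dots> \<le> measure lebesgue ?S + measure lebesgue ({0..1/100} \<union> {99/100..1::real})"
    using S by (intro measure_Un_le) auto
  also have "measure lebesgue ({0..1/100} \<union> {99/100..1::real}) \<le> measure lebesgue {0..1/100::real} + measure lebesgue {99/100..1::real}"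
    by (intro measure_Un_le) auto
  finally have "germ_mass h (- V) \<le> measure lebesgue ?S + 1/50" by simp
  moreover have "germ_mass h V + germ_mass h (- V) \<ge> 1"
    using h germ_mass_Compl[of h A V] by (simp add: H_set_def)
  ultimately show ?thesis using up by linarith
qed

section \<open>Finitely additive measures and the conclusion\<close>

locale finitely_additive =
  fixes \<Omega> :: "'a set" and \<mu> :: "'a set \<Rightarrow> real"
  assumes nonneg: "X \<subseteq> \<Omega> \<Longrightarrow> \<mu> X \<ge> 0"
    and total: "\<mu> \<Omega> = 1"
    and additive: "X \<subseteq> \<Omega> \<Longrightarrow> Y \<subseteq> \<Omega> \<Longrightarrow> X \<inter> Y = {} \<Longrightarrow> \<mu> (X \<union> Y) = \<mu> X + \<mu> Y"
begin

lemma empty: "\<mu> {} = 0"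
  using additive[of "{}" "{}"] by simp

lemma mono:
  assumes "X \<subseteq> Y" "Y \<subseteq> \<Omega>"
  shows "\<mu> X \<le> \<mu> Y"
proof -
  have "\<mu> (X \<union> (Y - X)) = \<mu> X + \<mu> (Y - X)" using assms by (intro additive) auto
  moreover have "X \<union> (Y - X) = Y" using assms by auto
  moreover have "\<mu> (Y - X) \<ge> 0" using assms by (intro nonneg) auto
  ultimately show ?thesis by simp
qed

lemma compl:
  assumes "X \<subseteq> \<Omega>"
  shows "\<mu> (\<Omega> - X) = 1 - \<mu> X"
proof -
  have "\<mu> (X \<union> (\<Omega> - X)) = \<mu> X + \<mu> (\<Omega> - X)" using assms by (intro additive) auto
  moreover have "X \<union> (\<Omega> - X) = \<Omega>" using assms by auto
  ultimately show ?thesis using total by simp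
qed

lemma finite_UN:
  assumes "finite I" "\<And>i. i \<in> I \<Longrightarrow> Z i \<subseteq> \<Omega>" "\<And>i j. i \<in> I \<Longrightarrow> j \<in> I \<Longrightarrow> i \<noteq> j \<Longrightarrow> Z i \<inter> Z j = {}"
  shows "\<mu> (\<Union>i\<in>I. Z i) = (\<Sum>i\<in>I. \<mu> (Z i))"
  using assms
proof (induction I)
  case (insert i I)
  have "\<mu> (Z i \<union> (\<Union>i\<in>I. Z i)) = \<mu> (Z i) + \<mu> (\<Union>i\<in>I. Z i)"
  proof (rule additive)
    show "Z i \<inter> (\<Union>i\<in>I. Z i) = {}"
    proof -
      have "Z i \<inter> Z j = {}" if "j \<in> I" for j using insert.prems(2)[of i j] insert.hyps that by blast
      then show ?thesis by blast
    qed
  qed (use insert.prems(1) in auto)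
  then show ?case using insert by simp
qed (simp add: empty)

text \<open>A finitely additive form of integrating the function that counts the sets containing a
  point: \<open>\<Omega>\<close> is split into the atoms \<open>Z \<sigma>\<close>, on which the set
  of indices is exactly \<open>\<sigma>\<close>, and the two sums are exchanged.\<close>

lemma sum_le_multiplicity:
  assumes I: "finite I" and X: "\<And>i. i \<in> I \<Longrightarrow> X i \<subseteq> \<Omega>"
    and k: "\<And>\<omega>. \<omega> \<in> \<Omega> \<Longrightarrow> card {i\<in>I. \<omega> \<in> X i} \<le> k"
  shows "(\<Sum>i\<in>I. \<mu> (X i)) \<le> real k"
proof -
  define Z where "Z \<sigma> = {\<omega>\<in>\<Omega>. {i\<in>I. \<omega> \<in> X i} = \<sigma>}" for \<sigma>
  have Zsub: "Z \<sigma> \<subseteq> \<Omega>" for \<sigma> by (auto simp: Z_def)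
  have Zdisj: "Z \<sigma> \<inter> Z \<tau> = {}" if "\<sigma> \<noteq> \<tau>" for \<sigma> \<tau> using that by (auto simp: Z_def)
  have fin: "finite (Pow I)" using I by simp
  have "\<mu> (X i) = (\<Sum>\<sigma>\<in>Pow I. if i \<in> \<sigma> then \<mu> (Z \<sigma>) else 0)" if i: "i \<in> I" for i
  proof -
    have "X i = (\<Union>\<sigma>\<in>{\<sigma>\<in>Pow I. i \<in> \<sigma>}. Z \<sigma>)"
    proof (intro equalityI subsetI)
      fix \<omega> assume "\<omega> \<in> X i"
      then show "\<omega> \<in> (\<Union>\<sigma>\<in>{\<sigma>\<in>Pow I. i \<in> \<sigma>}. Z \<sigma>)"
        using X[OF i] i by (intro UN_I[of "{i\<in>I. \<omega> \<in> X i}"]) (auto simp: Z_def)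
    qed (auto simp: Z_def)
    then have "\<mu> (X i) = (\<Sum>\<sigma>\<in>{\<sigma>\<in>Pow I. i \<in> \<sigma>}. \<mu> (Z \<sigma>))"
      using finite_UN[of "{\<sigma>\<in>Pow I. i \<in> \<sigma>}" Z] fin Zsub Zdisj by simp
    also have "\<dots> = (\<Sum>\<sigma>\<in>Pow I. if i \<in> \<sigma> then \<mu> (Z \<sigma>) else 0)"
      using fin by (rule sum.inter_filter)
    finally show ?thesis .
  qed
  then have "(\<Sum>i\<in>I. \<mu> (X i)) = (\<Sum>i\<in>I. \<Sum>\<sigma>\<in>Pow I. if i \<in> \<sigma> then \<mu> (Z \<sigma>) else 0)" by simp
  also have "\<dots> = (\<Sum>\<sigma>\<in>Pow I. \<Sum>i\<in>I. if i \<in> \<sigma> then \<mu> (Z \<sigma>) else 0)" by (rule sum.swap)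
  also have "\<dots> \<le> (\<Sum>\<sigma>\<in>Pow I. real k * \<mu> (Z \<sigma>))"
  proof (rule sum_mono)
    fix \<sigma> assume "\<sigma> \<in> Pow I"
    then have "{i\<in>I. i \<in> \<sigma>} = \<sigma>" by auto
    then have e: "(\<Sum>i\<in>I. if i \<in> \<sigma> then \<mu> (Z \<sigma>) else 0) = real (card \<sigma>) * \<mu> (Z \<sigma>)"
      using I by (simp flip: sum.inter_filter)
    show "(\<Sum>i\<in>I. if i \<in> \<sigma> then \<mu> (Z \<sigma>) else 0) \<le> real k * \<mu> (Z \<sigma>)"
    proof (cases "Z \<sigma> = {}")
      case False
      then obtain \<omega> where "\<omega> \<in> \<Omega>" "{i\<in>I. \<omega> \<in> X i} = \<sigma>" by (auto simp: Z_def)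
      then have "card \<sigma> \<le> k" using k by blast
      then show ?thesis unfolding e using nonneg[OF Zsub] by (intro mult_right_mono) auto
    next
      case True
      then have "\<mu> (Z \<sigma>) = 0" by (simp add: empty)
      then show ?thesis unfolding e by simp
    qed
  qed
  also have "\<dots> = real k * \<mu> (\<Union>\<sigma>\<in>Pow I. Z \<sigma>)"
    using finite_UN[of "Pow I" Z] fin Zsub Zdisj by (simp add: sum_distrib_left)
  also have "\<dots> \<le> real k * \<mu> \<Omega>" using mono[of "\<Union>\<sigma>\<in>Pow I. Z \<sigma>" \<Omega>] Zsub
    by (intro mult_left_mono) auto
  finally show ?thesis using total by simp
qed

end

text \<open>If \<open>k + 1\<close> of the numbers exceeded \<open>c\<close>, their sum would exceed
  \<open>c * (k + 1)\<close>, hence 1.\<close>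

lemma card_above_threshold:
  fixes m :: "'i \<Rightarrow> real"
  assumes I: "finite I" and m: "\<And>i. i \<in> I \<Longrightarrow> m i \<ge> 0" "(\<Sum>i\<in>I. m i) \<le> 1" and c: "c * real (Suc k) \<ge> 1" "c > 0"
  shows "card {i\<in>I. m i > c} \<le> k"
proof (rule ccontr)
  let ?J = "{i\<in>I. m i > c}"
  assume "\<not> card ?J \<le> k"
  then have "real (Suc k) \<le> real (card ?J)" by simp
  then have "?J \<noteq> {}" by (metis card.empty of_nat_0 of_nat_0_less_iff not_less zero_less_Suc)
  have "c * real (Suc k) \<le> c * real (card ?J)" using c(2) \<open>real (Suc k) \<le> real (card ?J)\<close> by (intro mult_left_mono) auto
  also have "\<dots> = (\<Sum>i\<in>?J. c)" by simp
  also have "\<dots> < (\<Sum>i\<in>?J. m i)" using I \<open>?J \<noteq> {}\<close> by (intro sum_strict_mono) auto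
  also have "\<dots> \<le> (\<Sum>i\<in>I. m i)" using I m(1) by (intro sum_mono2) auto
  finally show False using m(2) c(1) by simp
qed

text \<open>Since \<open>A\<close> contains the integers properly, it contains a nonzero fractional
  part \<open>x\<close>. The powers of \<open>x\<close> become small, and arbitrarily late ones
  avoid all zeros of \<open>unit_dominant\<close> polynomials.\<close>

lemma small_generic_element:
  assumes A: "subring_real A" "A \<noteq> \<int>"
  shows "\<exists>t\<in>A. 0 < t \<and> t \<le> 1/2000 \<and> (\<forall>q. unit_dominant q \<longrightarrow> ieval q t \<noteq> 0)"
proof -
  have nat: "of_nat n \<in> A" for n using A(1) by (induction n) (simp_all add: subring_real_def)
  have int: "of_int i \<in> A" for i
    using nat subring_minus[OF A(1)] by (cases i rule: int_cases2) auto
  then have "\<int> \<subseteq> A" by (auto elim: Ints_cases)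
  then obtain \<theta> where \<theta>: "\<theta> \<in> A" "\<theta> \<notin> \<int>" using A(2) by blast
  define x where "x = frac \<theta>"
  have "x \<in> A" using \<theta>(1) int A(1) by (simp add: x_def frac_def subring_real_def)
  have x: "0 < x" "x < 1" using \<theta>(2) by (simp_all add: x_def frac_lt_1)
  have pow: "x ^ n \<in> A" for n using A(1) \<open>x \<in> A\<close> by (induction n) (simp_all add: subring_real_def)
  obtain N where N: "x ^ N < 1/2000" using real_arch_pow_inv[of "1/2000" x] x by auto
  obtain n where n: "n \<ge> N" "\<forall>q. unit_dominant q \<longrightarrow> ieval q (x ^ n) \<noteq> 0"
    using power_not_root_unit_dominant[OF x] by blast
  have "x ^ n \<le> x ^ N" using n(1) x by (intro power_decreasing) auto
  then have "x ^ n \<le> 1/2000" using N by linarith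
  then show ?thesis using n(2) pow x N by (intro bexI[of _ "x ^ n"]) auto
qed

theorem theorem1:
  fixes A :: "real set"
  assumes "subring_real A" and "A \<noteq> \<int>"
  shows "\<not> amenable (H_grp A)"
proof
  assume "amenable (H_grp A)"
  then have "\<exists>\<mu>. (\<forall>X \<subseteq> H_set A. \<mu> X \<ge> (0 :: real)) \<and> \<mu> (H_set A) = 1 \<and>
      (\<forall>X Y. X \<subseteq> H_set A \<longrightarrow> Y \<subseteq> H_set A \<longrightarrow> X \<inter> Y = {} \<longrightarrow> \<mu> (X \<union> Y) = \<mu> X + \<mu> Y) \<and>
      (\<forall>g\<in>H_set A. \<forall>X \<subseteq> H_set A. \<mu> ((\<lambda>h. g \<circ> h) ` X) = \<mu> X)"
    unfolding amenable_def H_grp_def partial_object.simps monoid.simps .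
  then obtain \<mu> :: "(P1 \<Rightarrow> P1) set \<Rightarrow> real" where mu: "(\<forall>X \<subseteq> H_set A. \<mu> X \<ge> 0) \<and> \<mu> (H_set A) = 1 \<and>
      (\<forall>X Y. X \<subseteq> H_set A \<longrightarrow> Y \<subseteq> H_set A \<longrightarrow> X \<inter> Y = {} \<longrightarrow> \<mu> (X \<union> Y) = \<mu> X + \<mu> Y) \<and>
      (\<forall>g\<in>H_set A. \<forall>X \<subseteq> H_set A. \<mu> ((\<lambda>h. g \<circ> h) ` X) = \<mu> X)"
    by (rule exE)
  interpret finitely_additive "H_set A" \<mu>
    by unfold_locales (use mu in auto)
  obtain t where t: "t \<in> A" "0 < t" "t \<le> 1/2000" "\<And>q. unit_dominant q \<Longrightarrow> ieval q t \<noteq> 0"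
    using small_generic_element[OF assms] by blast
  define K where "K s = gen_mat t s" for s
  have K: "K s \<in> SL2 A" "near_one (K s)" "minv (K s) = K (inv_letter s)" for s
    using gen_mat_SL2[OF assms(1) t(1)] near_one_gen_mat[OF t(2,3)] by (simp_all add: K_def gen_mat_inv)
  have Kinv: "mob (K s) \<circ> mob (K (inv_letter s)) = id" for s
    using mob_minv(1)[OF K(1)] K(3) by metis
  have free: "word_map (\<lambda>s. mob (K s)) w \<noteq> id" if "reduced w" "w \<noteq> []" for w
    unfolding K_def by (rule gen_mat_free[OF t(4) that])
  obtain W :: "letter \<Rightarrow> (P1 \<Rightarrow> P1) set" where
    W1: "\<And>s t \<gamma>. inj \<gamma> \<Longrightarrow> \<gamma> \<in> W s \<Longrightarrow> \<gamma> \<in> W t \<Longrightarrow> s = t" and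
    W2: "\<And>s \<gamma>. \<gamma> \<notin> W (inv_letter s) \<Longrightarrow> \<gamma> \<circ> mob (K s) \<in> W s"
    using free_coset_decomposition[of "\<lambda>s. mob (K s)", OF Kinv free] by blast
  \<comment> \<open>The four masses add up to at most 1, so at most two of them exceed 2/5 and at
    most one exceeds 1/2. The thresholds fit the translation estimate: \<open>1 - 2/5 - 1/50\<close>
    is larger than \<open>101/100 * (1/2)\<close>.\<close>
  define X where "X s = {h \<in> H_set A. germ_mass h (W s) > 2/5}" for s
  define Y where "Y s = {h \<in> H_set A. germ_mass h (W s) > 1/2}" for s
  have H_inj: "inj h" if "h \<in> H_set A" for h
    using that homeomorphic_imp_injective_map[OF G_set_homeo[of h A]] by (simp add: H_set_def)
  have sum1: "(\<Sum>s\<in>UNIV. germ_mass h (W s)) \<le> 1" if "h \<in> H_set A" for h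
    using germ_mass_sum_le[OF H_inj[OF that], of UNIV W] W1 by simp
  have "(\<Sum>s\<in>UNIV. \<mu> (X s)) \<le> real 2"
  proof (rule sum_le_multiplicity)
    show "card {s \<in> UNIV. h \<in> X s} \<le> 2" if h: "h \<in> H_set A" for h
      using card_above_threshold[of UNIV "\<lambda>s. germ_mass h (W s)" "2/5" 2] sum1[OF h] germ_mass_nonneg h
      by (simp add: X_def)
  qed (auto simp: X_def)
  moreover have "(\<Sum>s\<in>UNIV. \<mu> (Y s)) \<le> real 1"
  proof (rule sum_le_multiplicity)
    show "card {s \<in> UNIV. h \<in> Y s} \<le> 1" if h: "h \<in> H_set A" for h
      using card_above_threshold[of UNIV "\<lambda>s. germ_mass h (W s)" "1/2" 1] sum1[OF h] germ_mass_nonneg h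
      by (simp add: Y_def)
  qed (auto simp: Y_def)
  \<comment> \<open>Left translation by the extension \<open>g\<close> of the inverse generator
    sends the complement of \<open>X (inv_letter s)\<close> into \<open>Y s\<close>; invariance of
    \<open>\<mu>\<close> then compares the two values.\<close>
  moreover have "1 - \<mu> (X (inv_letter s)) \<le> \<mu> (Y s)" for s
  proof -
    obtain g where g: "g \<in> H_set A" "\<And>u. 0 \<le> u \<Longrightarrow> u \<le> 1 \<Longrightarrow> g (Some u) = mob (minv (K s)) (Some u)"
      using near_one_H_set_extension[OF assms(1), of "minv (K s)"] K by metis
    have "(\<lambda>h. g \<circ> h) ` (H_set A - X (inv_letter s)) \<subseteq> Y s"
    proof
      fix f assume "f \<in> (\<lambda>h. g \<circ> h) ` (H_set A - X (inv_letter s))"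
      then obtain h where h: "h \<in> H_set A" "h \<notin> X (inv_letter s)" "f = g \<circ> h" by blast
      have "near_one (minv (K s))" using K by simp
      from germ_mass_translate[OF assms(1) K(1) K(2) this h(1) g(2) W2]
      have "1 - germ_mass h (W (inv_letter s)) - 1/50 \<le> 101/100 * germ_mass f (W s)" by (simp add: h(3))
      moreover have "germ_mass h (W (inv_letter s)) \<le> 2/5" using h by (simp add: X_def)
      ultimately have "germ_mass f (W s) > 1/2" by linarith
      then show "f \<in> Y s" using H_set_comp[OF assms(1) g(1) h(1)] by (simp add: Y_def h(3))
    qed
    then have "\<mu> ((\<lambda>h. g \<circ> h) ` (H_set A - X (inv_letter s))) \<le> \<mu> (Y s)"
      by (intro mono) (auto simp: Y_def)
    then have "\<mu> (H_set A - X (inv_letter s)) \<le> \<mu> (Y s)" using mu g(1) by simp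
    then show ?thesis using compl[of "X (inv_letter s)"] by (simp add: X_def)
  qed
  \<comment> \<open>Summing over the four letters, which inversion permutes, gives 4 minus the total
    of the \<open>X s\<close> as a lower bound for the total of the \<open>Y s\<close>. These totals
    are at most 2 and 1, a contradiction.\<close>
  then have "(\<Sum>s\<in>UNIV. 1 - \<mu> (X (inv_letter s))) \<le> (\<Sum>s\<in>UNIV. \<mu> (Y s))" by (rule sum_mono)
  moreover have "(\<Sum>s\<in>UNIV. \<mu> (X (inv_letter s))) = (\<Sum>s\<in>UNIV. \<mu> (X s))"
    by (rule sum.reindex_bij_witness[of _ inv_letter inv_letter]) simp_all
  moreover have "card (UNIV :: letter set) = 4" by (simp add: card_UNIV_bool flip: UNIV_Times_UNIV)
  ultimately show False by (simp add: sum_subtractf)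
qed

end
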